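(* For every $t \in \mathbb{N}$ there exists $n_0 = n_0(t)$ such that for all $n \geq n_0$ the following holds: if $\mathcal{F} \subset S_n$ is $(t-1)$-intersection-free, then $|\mathcal{F}| \leq (n-t)!$, with equality only if $\mathcal{F}$ is a coset (in $S_n$) of the pointwise stabilizer of a $t$-element subset of $\{1,\ldots,n\}$.
   Context: $S_n$ denotes the symmetric group on $[n]=\{1,2,\ldots,n\}$. Two permutations $\sigma,\tau\in S_n$ agree on exactly $k$ points if $|\{i \in [n] : \sigma(i)=\tau(i)\}| = k$. A family $\mathcal{F} \subset S_n$ is $(t-1)$-intersection-free if for any two distinct $\sigma,\tau \in \mathcal{F}$ we have $|\{i \in [n] : \sigma(i)=\tau(i)\}| \neq t-1$. A coset of the pointwise stabilizer of a $t$-element set is the same thing as a family of the form $\{\sigma \in S_n : \sigma(j)=\pi(j)\ \forall j \in S\}$, where $\pi:S \to T$ is a bijection between $t$-element subsets $S,T$ of $[n]$. *)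

theory Defs
  imports Complex_Main "HOL-Algebra.Sym_Groups"
begin

definition agreement_set :: "nat \<Rightarrow> (nat \<Rightarrow> nat) \<Rightarrow> (nat \<Rightarrow> nat) \<Rightarrow> nat set"
  where "agreement_set n \<sigma> \<tau> = {i \<in> {1..n}. \<sigma> i = \<tau> i}"

(* The forbidden size k is an integer, so that k = t - 1 makes sense for t = 0 as well,
   without truncated subtraction. *)
definition intersection_free :: "nat \<Rightarrow> int \<Rightarrow> (nat \<Rightarrow> nat) set \<Rightarrow> bool"
  where "intersection_free n k F \<longleftrightarrow>
    (\<forall>\<sigma>\<in>F. \<forall>\<tau>\<in>F. \<sigma> \<noteq> \<tau> \<longrightarrow> int (card (agreement_set n \<sigma> \<tau>)) \<noteq> k)"

definition pointwise_stabilizer :: "nat \<Rightarrow> nat set \<Rightarrow> (nat \<Rightarrow> nat) set"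
  where "pointwise_stabilizer n S = {\<sigma> \<in> carrier (sym_group n). \<forall>i\<in>S. \<sigma> i = i}"

(* Left cosets suffice: a right coset of the pointwise stabilizer of S is a left coset of
   the pointwise stabilizer of another set of the same size. *)
definition is_stabilizer_coset :: "nat \<Rightarrow> nat \<Rightarrow> (nat \<Rightarrow> nat) set \<Rightarrow> bool"
  where "is_stabilizer_coset n t F \<longleftrightarrow>
    (\<exists>S \<tau>. S \<subseteq> {1..n} \<and> card S = t \<and> \<tau> \<in> carrier (sym_group n) \<and>
       F = \<tau> <#\<^bsub>sym_group n\<^esub> pointwise_stabilizer n S)"

lemma l_coset_pointwise_stabilizer:
  assumes "\<tau> \<in> carrier (sym_group n)"
  shows "\<tau> <#\<^bsub>sym_group n\<^esub> pointwise_stabilizer n S =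
    {\<sigma> \<in> carrier (sym_group n). \<forall>j\<in>S. \<sigma> j = \<tau> j}"
proof (intro equalityI subsetI)
  fix \<sigma> assume "\<sigma> \<in> \<tau> <#\<^bsub>sym_group n\<^esub> pointwise_stabilizer n S"
  then show "\<sigma> \<in> {\<sigma> \<in> carrier (sym_group n). \<forall>j\<in>S. \<sigma> j = \<tau> j}"
    using assms
    by (auto simp: l_coset_def pointwise_stabilizer_def sym_group_def permutes_compose)
next
  fix \<sigma> assume "\<sigma> \<in> {\<sigma> \<in> carrier (sym_group n). \<forall>j\<in>S. \<sigma> j = \<tau> j}"
  then have s: "\<sigma> permutes {1..n}" and e: "\<forall>j\<in>S. \<sigma> j = \<tau> j"
    by (auto simp: sym_group_carrier)
  have t: "\<tau> permutes {1..n}" using assms by (simp add: sym_group_carrier)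
  let ?h = "inv' \<tau> \<circ> \<sigma>"
  have "?h \<in> pointwise_stabilizer n S"
    using e permutes_compose[OF s permutes_inv[OF t]] permutes_inverses(2)[OF t]
    by (simp add: pointwise_stabilizer_def sym_group_carrier)
  moreover have "\<sigma> = \<tau> \<circ> ?h" using permutes_inverses(1)[OF t] by auto
  ultimately show "\<sigma> \<in> \<tau> <#\<^bsub>sym_group n\<^esub> pointwise_stabilizer n S"
    unfolding l_coset_def sym_group_mult by blast
qed

end

theory Submission
  imports Defs "HOL-Real_Asymp.Real_Asymp"
begin

text \<open>
  Identify a permutation of an n-set A with its graph, a set of n cells in A \<times> A. The number
  of points on which two permutations agree is then the size of the intersection of their graphs,
  and a coset of the pointwise stabilizer of a t-set consists of all graphs that contain a
  fixed set of t cells. The case t = 0 is trivial; let t be positive and let \<F> be a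
  family in which no two members meet in exactly t - 1 cells.

  The proof approximates \<F> by the cells that its large pieces have in common. A family \<G> of
  sets containing B is spread over B if prescribing k further elements shrinks it by a factor of
  about R^k or more. Here R is n divided by a small power of n, while the family of all
  graphs shrinks by about n^k. Maximizing |{F \<in> \<F>. B \<subseteq> F}| R^|B| over B shows that
  every subfamily of \<F> that is not tiny contains a large subfamily spread over some set B
  (ex_core). Such a B is called a core of \<F>. It has bounded size, because fixing many cells
  leaves too few permutations.

  Any two cores B1, B2 meet in at least t cells (cores_intersect). Suppose that they meet in fewer,
  and let \<G>1, \<G>2 be the corresponding spread families. By counting, almost every row contains
  more than n/2 cells lying on a fair share of \<G>1, and the same is true of \<G>2; hence some cell
  outside B1 and B2 lies on a fair share of both (common_dense_cell). Fixing such cells one at a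
  time enlarges the common part of B1 and B2 to exactly t - 1 cells, while both families stay
  spread with a slightly worse constant. It remains to find one member in each family such that
  they have nothing else in common. For this, choose a random set W of cells. A spread family
  has, with probability more than 1/2, a member inside W apart from its core
  (contains_none_mean). The complement of W has the same distribution as W, so for some W one
  family has such a member inside W and the other one outside W. These two members meet in
  exactly t - 1 cells, which is forbidden. The probability estimate is the theorem on spread
  families behind the recent bounds for sunflowers, proved by counting minimal fragments as Park
  and Pham do for the Kahn-Kalai conjecture.

  Pairwise intersections of size at least t and bounded size force a dichotomy
  (common_subset_or_few_larger_subsets): either there are boundedly many sets of t + 1 cells such
  that every core contains one of them, and then \<F> has O((n - t - 1)!) members; or one set T of t
  cells lies in every core, and then all but a tiny part of \<F> contains T. In the second case a
  single member F0 of \<F> that does not contain T already excludes (n - 2t - 1)! graphs through T, namely graphs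
  that meet F0 in exactly t - 1 cells (many_perms_agreeing_exactly). This is more than the tiny
  part can make up for. So \<F> either has fewer than (n - t)! members or lies entirely in
  the coset given by T.
\<close>

section \<open>Random sets and families with costly covers\<close>

text \<open>
  This is the expected value of f at a random subset of V that contains each element independently
  with probability p, written as a finite sum.
\<close>
definition subset_mean :: "'a set \<Rightarrow> real \<Rightarrow> ('a set \<Rightarrow> real) \<Rightarrow> real" where
  "subset_mean V p f = (\<Sum>W\<in>Pow V. p ^ card W * (1 - p) ^ card (V - W) * f W)"

lemma subset_mean_empty [simp]: "subset_mean {} p f = f {}"
  by (simp add: subset_mean_def)

lemma subset_mean_insert:
  assumes "finite V" "x \<notin> V"
  shows "subset_mean (insert x V) p f = p * subset_mean V p (\<lambda>W. f (insert x W)) + (1 - p) * subset_mean V p f"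
proof -
  have inj: "inj_on (insert x) (Pow V)" using assms(2) by (auto simp: inj_on_def)
  have disj: "Pow V \<inter> insert x ` Pow V = {}" using assms(2) by auto
  let ?g = "\<lambda>W. p ^ card W * (1 - p) ^ card (insert x V - W) * f W"
  have "subset_mean (insert x V) p f = sum ?g (Pow V) + sum ?g (insert x ` Pow V)"
    unfolding subset_mean_def Pow_insert using disj assms(1) by (subst sum.union_disjoint) auto
  also have "sum ?g (insert x ` Pow V) = (\<Sum>W\<in>Pow V. p * (p ^ card W * (1 - p) ^ card (V - W) * f (insert x W)))"
  proof (subst sum.reindex[OF inj], rule sum.cong, goal_cases)
    case (2 W)
    then have "finite W" "x \<notin> W" using assms by (auto intro: finite_subset)
    moreover have "insert x V - insert x W = V - W" using assms(2) by auto
    ultimately show ?case by simp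
  qed simp
  also have "sum ?g (Pow V) = (\<Sum>W\<in>Pow V. (1 - p) * (p ^ card W * (1 - p) ^ card (V - W) * f W))"
  proof (rule sum.cong, goal_cases)
    case (2 W)
    then have "insert x V - W = insert x (V - W)" using assms(2) by auto
    then show ?case using assms by simp
  qed simp
  finally show ?thesis by (simp add: subset_mean_def sum_distrib_left)
qed

lemma subset_mean_linear: "subset_mean V p (\<lambda>W. a * f W + b * g W) = a * subset_mean V p f + b * subset_mean V p g"
  by (simp add: subset_mean_def algebra_simps sum.distrib sum_distrib_left)

lemma subset_mean_const: "finite V \<Longrightarrow> subset_mean V p (\<lambda>_. c) = c"
  by (induction V rule: finite_induct) (auto simp: subset_mean_insert algebra_simps)

lemma subset_mean_mono:
  assumes "0 \<le> p" "p \<le> 1" "\<And>W. W \<subseteq> V \<Longrightarrow> f W \<le> g W"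
  shows "subset_mean V p f \<le> subset_mean V p g"
  unfolding subset_mean_def using assms by (intro sum_mono mult_left_mono) auto

lemma subset_mean_nonneg:
  assumes "0 \<le> p" "p \<le> 1" "\<And>W. W \<subseteq> V \<Longrightarrow> 0 \<le> f W"
  shows "0 \<le> subset_mean V p f"
  unfolding subset_mean_def using assms by (intro sum_nonneg) auto

text \<open>
  The union of independent random sets with densities p and q is random with density
  1 - (1 - p) (1 - q), since each element is missed independently by both. This allows a random set
  to be exposed in several rounds.
\<close>
lemma subset_mean_union:
  assumes "finite V"
  shows "subset_mean V p (\<lambda>W1. subset_mean V q (\<lambda>W2. f (W1 \<union> W2))) = subset_mean V (1 - (1 - p) * (1 - q)) f"
  using assms
proof (induction V arbitrary: f rule: finite_induct)
  case (insert x V)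
  note ins = subset_mean_insert[OF insert.hyps]
  have a: "subset_mean V p (\<lambda>W1. subset_mean V q (\<lambda>W2. f (insert x (W1 \<union> W2)))) =
      subset_mean V (1 - (1 - p) * (1 - q)) (\<lambda>W. f (insert x W))"
    by (rule insert.IH)
  show ?case
    by (simp add: ins subset_mean_linear a insert.IH) (simp add: algebra_simps)
qed simp

text \<open>
  At density 1/2 all subsets have the same weight.
\<close>
lemma subset_mean_complement:
  assumes "finite V"
  shows "subset_mean V (1/2) (\<lambda>W. f (V - W)) = subset_mean V (1/2) f"
proof -
  have w: "(1/2) ^ card W * (1 - 1/2) ^ card (V - W) = (1/2::real) ^ card V" if "W \<subseteq> V" for W
  proof -
    have "card W + card (V - W) = card V"
      using that assms card_mono[OF assms that] card_Diff_subset[of W V] finite_subset[OF that assms] by auto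
    then show ?thesis by (simp flip: power_add)
  qed
  have "(\<Sum>W\<in>Pow V. f (V - W)) = (\<Sum>W\<in>Pow V. f W)"
    by (rule sum.reindex_bij_witness[of _ "\<lambda>W. V - W" "\<lambda>W. V - W"]) (auto simp: double_diff)
  moreover have "subset_mean V (1/2) g = (1/2) ^ card V * sum g (Pow V)" for g
    unfolding subset_mean_def sum_distrib_left by (rule sum.cong) (use w in auto)
  ultimately show ?thesis by simp
qed

definition minimal_sets :: "'a set set \<Rightarrow> 'a set set" where
  "minimal_sets H = {T \<in> H. \<forall>T'\<in>H. T' \<subseteq> T \<longrightarrow> T' = T}"

lemma ex_minimal_subset:
  assumes "S \<in> H" "finite S"
  shows "\<exists>T\<in>minimal_sets H. T \<subseteq> S"
  using assms(2,1)
proof (induction S rule: finite_psubset_induct)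
  case (psubset S)
  show ?case
  proof (cases "S \<in> minimal_sets H")
    case False
    then obtain T where "T \<in> H" "T \<subset> S" using psubset.prems by (auto simp: minimal_sets_def)
    moreover from this obtain T' where "T' \<in> minimal_sets H" "T' \<subseteq> T"
      using psubset.IH[of T] by auto
    ultimately show ?thesis by (intro bexI[of _ T']) auto
  qed auto
qed

abbreviation residues :: "'a set set \<Rightarrow> 'a set \<Rightarrow> 'a set set" where
  "residues H W \<equiv> (\<lambda>S. S - W) ` H"

text \<open>
  A set T costs (1 / R)^|T|. After W has been exposed, only the residues S - W are still needed,
  and among them only the minimal ones matter. The point is that a minimal residue T is nearly
  determined by Z = W \<union> T: if S is any member of H inside Z, then S - W is a residue contained in
  T, hence equal to T, so that T \<subseteq> S. For given Z there are thus at most 2^|S| candidates for T.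
  Passing from W to Z changes the probability by at most a factor p^(-|T|), and for large T
  the cost (1 / R)^|T| outweighs both losses.
\<close>
lemma mean_cost_large_residues:
  assumes V: "finite V" and H: "H \<subseteq> Pow V" and size: "\<And>S. S \<in> H \<Longrightarrow> card S \<le> 2 * k"
    and k: "k \<ge> 1" and p: "0 < p" "p < 1" and R: "4 / (p * R) \<le> 1" "R > 0"
  shows "subset_mean V p (\<lambda>W. \<Sum>T\<in>{T \<in> minimal_sets (residues H W). k \<le> card T}. (1 / R) ^ card T) \<le> 4 / (p * R)"
proof -
  define P where "P = (\<lambda>W. p ^ card W * (1 - p) ^ card (V - W))"
  define y where "y = 1 / (p * R)"
  have y: "0 < y" "4 * y \<le> 1" using p R by (auto simp: y_def)
  define L where "L = (\<lambda>W. {T \<in> minimal_sets (residues H W). k \<le> card T})"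
  \<comment> \<open>one member of H inside Z, fixed in advance; B Z collects the candidates for T\<close>
  define pick where "pick = (\<lambda>Z. SOME S. S \<in> H \<and> S \<subseteq> Z)"
  define B where "B = (\<lambda>Z. {T. (\<exists>S\<in>H. S \<subseteq> Z) \<and> T \<subseteq> pick Z \<and> k \<le> card T})"
  have finH: "finite H" using V H finite_subset by auto
  have pick: "pick Z \<in> H \<and> pick Z \<subseteq> Z" if "\<exists>S\<in>H. S \<subseteq> Z" for Z
    unfolding pick_def using someI_ex[of "\<lambda>S. S \<in> H \<and> S \<subseteq> Z"] that by blast
  have finL: "finite (L W)" for W
    using finH by (simp add: L_def minimal_sets_def)
  have finB: "finite (B Z)" for Z
  proof (cases "\<exists>S\<in>H. S \<subseteq> Z")
    case True
    then have "finite (pick Z)" using pick H V by (meson PowD finite_subset subsetD)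
    then show ?thesis unfolding B_def by (auto intro: finite_subset[of _ "Pow (pick Z)"])
  qed (auto simp: B_def)
  \<comment> \<open>the minimality of T confines it to the subsets of pick (W \<union> T)\<close>
  have key: "W \<inter> T = {} \<and> T \<subseteq> V \<and> T \<in> B (W \<union> T)" if W: "W \<subseteq> V" and T: "T \<in> L W" for W T
  proof -
    obtain S where S: "S \<in> H" "T = S - W" using T by (auto simp: L_def minimal_sets_def)
    have ex: "\<exists>S\<in>H. S \<subseteq> W \<union> T" by (rule bexI[OF _ S(1)]) (use S(2) in blast)
    have "pick (W \<union> T) - W \<in> residues H W" by (rule imageI) (use pick[OF ex] in blast)
    moreover have "pick (W \<union> T) - W \<subseteq> T" using pick[OF ex] by blast
    moreover have "\<forall>T'\<in>residues H W. T' \<subseteq> T \<longrightarrow> T' = T" "k \<le> card T"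
      using T by (simp_all add: L_def minimal_sets_def)
    ultimately have "pick (W \<union> T) - W = T" by blast
    then have "T \<subseteq> pick (W \<union> T)" by (metis Diff_subset)
    then have "T \<in> B (W \<union> T)" using ex \<open>k \<le> card T\<close> unfolding B_def by blast
    then show ?thesis using S H by blast
  qed
  \<comment> \<open>moving T from the complement of W into W costs a factor ((1 - p) / p)^|T|\<close>
  have PW: "P W * (1 / R) ^ card T \<le> P (W \<union> T) * y ^ card T"
    if W: "W \<subseteq> V" and T: "W \<inter> T = {}" "T \<subseteq> V" for W T
  proof -
    have f: "finite W" "finite T" using W T V by (auto intro: finite_subset)
    have c1: "card (W \<union> T) = card W + card T" using f T by (simp add: card_Un_disjoint)
    have VW: "V - W = (V - (W \<union> T)) \<union> T" using T by auto
    have c2: "card (V - W) = card (V - (W \<union> T)) + card T"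
      unfolding VW using V f by (subst card_Un_disjoint) auto
    have "(1 - p) ^ card T \<le> 1" using p by (simp add: power_le_one)
    then have "P W * (1 / R) ^ card T \<le> p ^ card W * (1 - p) ^ card (V - (W \<union> T)) * 1 * (1 / R) ^ card T"
      unfolding P_def c2 power_add using p R
      by (intro mult_right_mono mult_left_mono) (auto simp: mult.assoc[symmetric] mult_left_le)
    also have "\<dots> = P (W \<union> T) * y ^ card T"
      unfolding P_def y_def c1 using p R by (simp add: power_add power_divide power_mult_distrib)
    finally show ?thesis .
  qed
  have Bsum: "(\<Sum>T\<in>B Z. y ^ card T) \<le> 4 * y" for Z
  proof (cases "\<exists>S\<in>H. S \<subseteq> Z")
    case True
    have fp: "finite (pick Z)" using pick[OF True] H V by (meson PowD finite_subset subsetD)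
    have "card (B Z) \<le> card (Pow (pick Z))" using fp by (intro card_mono) (auto simp: B_def)
    also have "\<dots> = 2 ^ card (pick Z)" using fp by (rule card_Pow)
    also have "\<dots> \<le> 2 ^ (2 * k)" using size pick[OF True] by (intro power_increasing) auto
    finally have cB: "real (card (B Z)) \<le> 2 ^ (2 * k)" by (metis of_nat_le_iff of_nat_numeral of_nat_power)
    have "(\<Sum>T\<in>B Z. y ^ card T) \<le> (\<Sum>T\<in>B Z. y ^ k)"
      using y by (intro sum_mono power_decreasing) (auto simp: B_def)
    also have "\<dots> \<le> 2 ^ (2 * k) * y ^ k" using cB y by (auto intro: mult_right_mono)
    also have "\<dots> = (4 * y) ^ k" by (simp add: power_mult power_mult_distrib)
    also have "\<dots> \<le> (4 * y) ^ 1" using y k by (intro power_decreasing) auto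
    finally show ?thesis by simp
  qed (use y in \<open>auto simp: B_def\<close>)
  have "subset_mean V p (\<lambda>W. \<Sum>T\<in>L W. (1 / R) ^ card T) = (\<Sum>W\<in>Pow V. \<Sum>T\<in>L W. P W * (1 / R) ^ card T)"
    by (simp add: subset_mean_def P_def sum_distrib_left)
  also have "\<dots> = (\<Sum>(W, T)\<in>Sigma (Pow V) L. P W * (1 / R) ^ card T)"
    using V finL by (subst sum.Sigma) auto
  also have "\<dots> \<le> (\<Sum>(W, T)\<in>Sigma (Pow V) L. P (W \<union> T) * y ^ card T)"
    by (rule sum_mono) (use key PW in \<open>auto simp: case_prod_beta\<close>)
  also have "\<dots> = (\<Sum>(Z, T)\<in>(\<lambda>(W, T). (W \<union> T, T)) ` Sigma (Pow V) L. P Z * y ^ card T)"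
  proof (subst sum.reindex)
    show "inj_on (\<lambda>(W, T). (W \<union> T, T)) (Sigma (Pow V) L)"
    proof (rule inj_on_inverseI)
      fix a assume "a \<in> Sigma (Pow V) L"
      then have "fst a \<inter> snd a = {}" using key[of "fst a" "snd a"] by auto
      then show "(\<lambda>(Z, T). (Z - T, T)) ((\<lambda>(W, T). (W \<union> T, T)) a) = a"
        by (cases a) auto
    qed
  qed (simp add: case_prod_beta comp_def)
  also have "\<dots> \<le> (\<Sum>(Z, T)\<in>Sigma (Pow V) B. P Z * y ^ card T)"
  proof (rule sum_mono2)
    show "finite (Sigma (Pow V) B)" using V finB by auto
    show "(\<lambda>(W, T). (W \<union> T, T)) ` Sigma (Pow V) L \<subseteq> Sigma (Pow V) B"
    proof (rule image_subsetI)
      fix a assume "a \<in> Sigma (Pow V) L"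
      then show "(\<lambda>(W, T). (W \<union> T, T)) a \<in> Sigma (Pow V) B"
        using key[of "fst a" "snd a"] by (cases a) auto
    qed
    show "0 \<le> (case b of (Z, T) \<Rightarrow> P Z * y ^ card T)" for b :: "'a set \<times> 'a set"
      using p y by (auto simp: P_def split: prod.splits)
  qed
  also have "\<dots> = (\<Sum>Z\<in>Pow V. P Z * (\<Sum>T\<in>B Z. y ^ card T))"
    using V finB by (subst sum.Sigma[symmetric]) (auto simp: sum_distrib_left)
  also have "\<dots> \<le> subset_mean V p (\<lambda>_. 4 * y)"
    unfolding subset_mean_def P_def using p Bsum by (intro sum_mono mult_left_mono) auto
  also have "\<dots> = 4 * y" using V by (rule subset_mean_const)
  finally show ?thesis by (simp add: L_def y_def)
qed

text \<open>
  This is the indicator of failure, real-valued so that its mean is the probability that the random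
  set contains no member of H.
\<close>
definition contains_none :: "'a set set \<Rightarrow> 'a set \<Rightarrow> real" where
  "contains_none H W = (if \<exists>S\<in>H. S \<subseteq> W then 0 else 1)"

text \<open>
  The hypothesis on c says that every cover U of H, that is, every family such that each member of
  H contains a member of U, costs at least c. The random set is exposed in M rounds, each of
  density p. One round replaces H by the minimal residues that have shrunk below half the size bound;
  the other minimal residues are put aside. Every cover of the new family together with
  the sets put aside covers H, so the lower bound c drops at most by the cost of these sets,
  which is at most 4 / (p R) on average. After M rounds the sizes are below 2^0: the family is
  empty, which is possible only for c \<le> 0, or it contains the empty set and a member has been found.
\<close>
lemma contains_none_mean_iterated:
  assumes V: "finite V" and p: "0 < p" "p < 1" and R: "4 / (p * R) \<le> 1" "R > 0"
  shows "H \<subseteq> Pow V \<Longrightarrow> (\<And>S. S \<in> H \<Longrightarrow> card S < 2 ^ M) \<Longrightarrow>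
    (\<And>U. U \<subseteq> Pow V \<Longrightarrow> (\<And>S. S \<in> H \<Longrightarrow> \<exists>T\<in>U. T \<subseteq> S) \<Longrightarrow> c \<le> (\<Sum>T\<in>U. (1 / R) ^ card T)) \<Longrightarrow>
    c * subset_mean V (1 - (1 - p) ^ M) (contains_none H) \<le> real M * (4 / (p * R))"
proof (induction M arbitrary: H c)
  case 0
  show ?case
  proof (cases "{} \<in> H")
    case True
    then have "contains_none H = (\<lambda>_. 0)" by (intro ext) (force simp: contains_none_def)
    then show ?thesis using V by (simp add: subset_mean_const)
  next
    case False
    have "H = {}" 
    proof (rule ccontr)
      assume "H \<noteq> {}"
      then obtain S where S: "S \<in> H" by auto
      then have "card S = 0" "finite S" using 0(1) 0(2)[OF S] V by (auto intro: finite_subset)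
      then show False using False S by auto
    qed
    then have "c \<le> 0" using 0(3)[of "{}"] by simp
    then show ?thesis using V by (simp add: subset_mean_def sum_nonneg \<open>H = {}\<close> contains_none_def mult_nonpos_nonneg)
  qed
next
  case (Suc M)
  let ?q = "1 - (1 - p) ^ M"
  have q: "0 \<le> ?q" "?q \<le> 1" using p by (auto simp: power_le_one)
  \<comment> \<open>L W is put aside after the first round, H' W survives to the next one\<close>
  define L where "L = (\<lambda>W. {T \<in> minimal_sets (residues H W). 2 ^ M \<le> card T})"
  define H' where "H' = (\<lambda>W. {T \<in> minimal_sets (residues H W). card T < 2 ^ M})"
  define u where "u = (\<lambda>W. \<Sum>T\<in>L W. (1 / R) ^ card T)"
  have cn: "0 \<le> contains_none G W" "contains_none G W \<le> 1" for G and W :: "'a set"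
    by (auto simp: contains_none_def)
  show ?case
  proof (cases "c \<le> 0")
    case True
    have "0 \<le> subset_mean V (1 - (1 - p) ^ Suc M) (contains_none H)"
      using p by (intro subset_mean_nonneg cn) (auto simp: power_le_one mult_le_one simp del: power_Suc)
    then have "c * subset_mean V (1 - (1 - p) ^ Suc M) (contains_none H) \<le> 0"
      using True by (simp add: mult_nonpos_nonneg)
    also have "0 \<le> real (Suc M) * (4 / (p * R))" using p R by simp
    finally show ?thesis .
  next
    case False
    have step: "c * subset_mean V ?q (\<lambda>W2. contains_none H (W1 \<union> W2)) \<le> real M * (4 / (p * R)) + u W1"
      if W1: "W1 \<subseteq> V" for W1
    proof -
      have sub: "minimal_sets (residues H W1) \<subseteq> Pow V"
        using Suc.prems(1) by (auto simp: minimal_sets_def)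
      have finL: "finite (L W1)" "finite (minimal_sets (residues H W1))"
        using sub V by (auto simp: L_def intro: finite_subset)
      have u0: "0 \<le> u W1" unfolding u_def using R by (intro sum_nonneg) auto
      have IH: "(c - u W1) * subset_mean V ?q (contains_none (H' W1)) \<le> real M * (4 / (p * R))"
      proof (rule Suc.IH)
        show "H' W1 \<subseteq> Pow V" using sub by (auto simp: H'_def)
        fix U assume U: "U \<subseteq> Pow V" "\<And>S. S \<in> H' W1 \<Longrightarrow> \<exists>T\<in>U. T \<subseteq> S"
        have "c \<le> (\<Sum>T\<in>U \<union> L W1. (1 / R) ^ card T)"
        proof (rule Suc.prems(3))
          show "U \<union> L W1 \<subseteq> Pow V" using U sub by (auto simp: L_def)
          fix S assume S: "S \<in> H"
          then have "finite (S - W1)" using Suc.prems(1) V by (auto intro: finite_subset)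
          then obtain T where T: "T \<in> minimal_sets (residues H W1)" "T \<subseteq> S - W1"
            using ex_minimal_subset[of "S - W1" "residues H W1"] S by auto
          show "\<exists>T\<in>U \<union> L W1. T \<subseteq> S"
          proof (cases "card T < 2 ^ M")
            case True
            then obtain T' where "T' \<in> U" "T' \<subseteq> T" using U(2)[of T] T by (auto simp: H'_def)
            then show ?thesis using T by auto
          qed (use T in \<open>auto simp: L_def\<close>)
        qed
        also have "\<dots> \<le> (\<Sum>T\<in>U. (1 / R) ^ card T) + (\<Sum>T\<in>L W1. (1 / R) ^ card T)"
          using finL U(1) V R by (subst sum_Un) (auto intro!: sum_nonneg intro: finite_subset)
        finally show "c - u W1 \<le> (\<Sum>T\<in>U. (1 / R) ^ card T)" by (simp add: u_def)
      qed (auto simp: H'_def)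
      have le1: "subset_mean V ?q (contains_none (H' W1)) \<le> 1"
        using subset_mean_mono[OF q, of V "contains_none (H' W1)" "\<lambda>_. 1"] cn V by (simp add: subset_mean_const)
      have ge0: "0 \<le> subset_mean V ?q (contains_none (H' W1))"
        by (intro subset_mean_nonneg q cn)
      have "contains_none H (W1 \<union> W2) \<le> contains_none (H' W1) W2" for W2
      proof -
        have "\<exists>S\<in>H. S \<subseteq> W1 \<union> W2" if "\<exists>S\<in>H' W1. S \<subseteq> W2"
          using that by (auto simp: H'_def minimal_sets_def)
        then show ?thesis by (auto simp: contains_none_def)
      qed
      then have "subset_mean V ?q (\<lambda>W2. contains_none H (W1 \<union> W2)) \<le> subset_mean V ?q (contains_none (H' W1))"
        by (intro subset_mean_mono q)
      then have "c * subset_mean V ?q (\<lambda>W2. contains_none H (W1 \<union> W2)) \<le> c * subset_mean V ?q (contains_none (H' W1))"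
        using False by (intro mult_left_mono) auto
      also have "\<dots> = (c - u W1) * subset_mean V ?q (contains_none (H' W1)) + u W1 * subset_mean V ?q (contains_none (H' W1))"
        by (simp add: algebra_simps)
      also have "\<dots> \<le> real M * (4 / (p * R)) + u W1 * 1"
        by (intro add_mono IH mult_left_mono le1 u0)
      finally show ?thesis by simp
    qed
    have mean_u: "subset_mean V p u \<le> 4 / (p * R)"
      unfolding u_def L_def
    proof (rule mean_cost_large_residues[OF V Suc.prems(1) _ _ p R])
      show "card S \<le> 2 * 2 ^ M" if "S \<in> H" for S using Suc.prems(2)[OF that] by simp
    qed simp
    have "c * subset_mean V (1 - (1 - p) ^ Suc M) (contains_none H) =
        subset_mean V p (\<lambda>W1. c * subset_mean V ?q (\<lambda>W2. contains_none H (W1 \<union> W2)))"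
      using subset_mean_union[OF V, of p ?q "contains_none H"]
        subset_mean_linear[of V p c "\<lambda>W1. subset_mean V ?q (\<lambda>W2. contains_none H (W1 \<union> W2))" 0 "\<lambda>_. 0"] by simp
    also have "\<dots> \<le> subset_mean V p (\<lambda>W. real M * (4 / (p * R)) + u W)"
      using p by (intro subset_mean_mono step) auto
    also have "\<dots> = real M * (4 / (p * R)) + subset_mean V p u"
      using subset_mean_linear[of V p 1 "\<lambda>_. real M * (4 / (p * R))" 1 u] V by (simp add: subset_mean_const)
    also have "\<dots> \<le> real (Suc M) * (4 / (p * R))" using mean_u by (simp only: of_nat_Suc distrib_right mult_1)
    finally show ?thesis .
  qed
qed

text \<open>
  With p = 1 - (1/2)^(1/M) the M rounds add up to a random set of density exactly 1/2, and
  Bernoulli's inequality gives p \<ge> 1 / (2 M).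
\<close>
lemma contains_none_mean:
  assumes V: "finite V" and M: "M \<ge> 1" and R: "8 * real M \<le> R"
    and H: "H \<subseteq> Pow V" "\<And>S. S \<in> H \<Longrightarrow> card S < 2 ^ M"
    and cost: "\<And>U. U \<subseteq> Pow V \<Longrightarrow> (\<And>S. S \<in> H \<Longrightarrow> \<exists>T\<in>U. T \<subseteq> S) \<Longrightarrow> c \<le> (\<Sum>T\<in>U. (1 / R) ^ card T)"
  shows "c * subset_mean V (1/2) (contains_none H) \<le> 8 * real M ^ 2 / R"
proof -
  define p where "p = 1 - root M (1/2)"
  have R0: "R > 0" using M R by linarith
  have p: "0 < p" "p < 1" using M by (auto simp: p_def)
  have half: "(1 - p) ^ M = 1/2" using M by (simp add: p_def real_root_pow_pos2)
  have pM: "1 / (2 * real M) \<le> p"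
  proof (rule ccontr)
    assume "\<not> ?thesis"
    then have "1 - 1 / (2 * real M) < 1 - p" by simp
    moreover have "0 \<le> 1 - 1 / (2 * real M)" using M by (simp add: field_simps)
    ultimately have "(1 - 1 / (2 * real M)) ^ M < (1 - p) ^ M"
      using M by (intro power_strict_mono) auto
    moreover have "1 + real M * (- (1 / (2 * real M))) \<le> (1 + (- (1 / (2 * real M)))) ^ M"
      using M by (intro Bernoulli_inequality) (simp add: field_simps)
    ultimately show False using half M by (simp add: field_simps)
  qed
  have "4 / (p * R) \<le> 4 / (1 / (2 * real M) * R)"
    using pM R0 M p by (intro divide_left_mono mult_right_mono mult_pos_pos) auto
  then have le: "4 / (p * R) \<le> 8 * real M / R" using M R0 by simp
  moreover have "8 * real M / R \<le> 1" using R R0 by simp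
  ultimately have "4 / (p * R) \<le> 1" by linarith
  then have "c * subset_mean V (1 - (1 - p) ^ M) (contains_none H) \<le> real M * (4 / (p * R))"
    by (intro contains_none_mean_iterated V p R0 H cost)
  also have "\<dots> \<le> real M * (8 * real M / R)" using le by (intro mult_left_mono) auto
  also have "\<dots> = 8 * real M ^ 2 / R" by (simp add: power2_eq_square)
  finally show ?thesis by (simp only: half) simp
qed

text \<open>
  A random set W of density 1/2 fails to contain a member of H1 with probability below 1/2, and its
  complement fails to contain a member of H2 with probability below 1/2. So for some W neither
  fails.
\<close>
lemma disjoint_members_if_covers_costly:
  assumes V: "finite V" and M: "M \<ge> 1" and R: "8 * real M \<le> R" "16 * real M ^ 2 / R < c"
    and H1: "H1 \<subseteq> Pow V" "\<And>S. S \<in> H1 \<Longrightarrow> card S < 2 ^ M"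
    and cost1: "\<And>U. U \<subseteq> Pow V \<Longrightarrow> (\<And>S. S \<in> H1 \<Longrightarrow> \<exists>T\<in>U. T \<subseteq> S) \<Longrightarrow> c \<le> (\<Sum>T\<in>U. (1 / R) ^ card T)"
    and H2: "H2 \<subseteq> Pow V" "\<And>S. S \<in> H2 \<Longrightarrow> card S < 2 ^ M"
    and cost2: "\<And>U. U \<subseteq> Pow V \<Longrightarrow> (\<And>S. S \<in> H2 \<Longrightarrow> \<exists>T\<in>U. T \<subseteq> S) \<Longrightarrow> c \<le> (\<Sum>T\<in>U. (1 / R) ^ card T)"
  shows "\<exists>S1\<in>H1. \<exists>S2\<in>H2. S1 \<inter> S2 = {}"
proof (rule ccontr)
  assume neg: "\<not> ?thesis"
  let ?e1 = "subset_mean V (1/2) (contains_none H1)" and ?e2 = "subset_mean V (1/2) (contains_none H2)"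
  have "subset_mean V (1/2) (\<lambda>_. 1) \<le> subset_mean V (1/2) (\<lambda>W. 1 * contains_none H1 W + 1 * contains_none H2 (V - W))"
  proof (rule subset_mean_mono)
    fix W assume "W \<subseteq> V"
    have "S1 \<inter> S2 = {}" if "S1 \<subseteq> W" "S2 \<subseteq> V - W" for S1 S2 using that by auto
    then have "\<not> ((\<exists>S\<in>H1. S \<subseteq> W) \<and> (\<exists>S\<in>H2. S \<subseteq> V - W))" using neg by meson
    then show "1 \<le> 1 * contains_none H1 W + 1 * contains_none H2 (V - W)"
      by (auto simp: contains_none_def)
  qed simp_all
  then have "1 \<le> ?e1 + ?e2"
    using V by (simp only: subset_mean_linear subset_mean_complement[OF V] subset_mean_const[OF V])
  moreover have "0 \<le> 16 * real M ^ 2 / R" using R(1) by (intro divide_nonneg_nonneg) auto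
  then have "c > 0" using R(2) by linarith
  ultimately have "c * 1 \<le> c * (?e1 + ?e2)" by (intro mult_left_mono) auto
  then have "c \<le> c * ?e1 + c * ?e2" by (simp only: distrib_left mult_1_right)
  also have "\<dots> \<le> 8 * real M ^ 2 / R + 8 * real M ^ 2 / R"
    by (intro add_mono contains_none_mean V M R(1) H1 H2 cost1 cost2)
  also have "\<dots> = 16 * real M ^ 2 / R" by simp
  finally show False using R(2) by simp
qed

section \<open>Counting permutations with prescribed values\<close>

lemma permutes_extending_injection:
  assumes A: "finite A" and D: "D \<subseteq> A" and f: "inj_on f D" "f ` D \<subseteq> A"
  shows "\<exists>\<pi>. \<pi> permutes A \<and> (\<forall>i\<in>D. \<pi> i = f i)"
proof -
  have fin: "finite D" "finite (A - D)" "finite (A - f ` D)" using A D finite_subset by auto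
  have "card (A - D) = card (A - f ` D)"
    using A D f fin by (simp add: card_Diff_subset card_image)
  then obtain g where g: "bij_betw g (A - D) (A - f ` D)"
    using fin finite_same_card_bij by blast
  define \<pi> where "\<pi> = (\<lambda>i. if i \<in> D then f i else if i \<in> A then g i else i)"
  have "bij_betw \<pi> D (f ` D)"
    using f by (auto simp: \<pi>_def bij_betw_def inj_on_def)
  moreover have "bij_betw \<pi> (A - D) (A - f ` D)"
    using g by (rule bij_betw_cong[THEN iffD1, rotated]) (auto simp: \<pi>_def)
  ultimately have "bij_betw \<pi> (D \<union> (A - D)) (f ` D \<union> (A - f ` D))"
    by (rule bij_betw_combine) auto
  moreover have "D \<union> (A - D) = A" "f ` D \<union> (A - f ` D) = A" using D f by auto
  ultimately have "\<pi> permutes A"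
    using D by (intro bij_imp_permutes) (auto simp: \<pi>_def)
  then show ?thesis by (auto simp: \<pi>_def)
qed

lemma card_permutes_agreeing_on:
  assumes A: "finite A" and D: "D \<subseteq> A" and \<pi>: "\<pi> permutes A"
  shows "card {\<rho>. \<rho> permutes A \<and> (\<forall>i\<in>D. \<rho> i = \<pi> i)} = fact (card A - card D)"
proof -
  have "{\<rho>. \<rho> permutes A \<and> (\<forall>i\<in>D. \<rho> i = \<pi> i)} = (\<lambda>\<kappa>. \<pi> \<circ> \<kappa>) ` {\<kappa>. \<kappa> permutes (A - D)}"
  proof (intro equalityI subsetI)
    fix \<rho> assume "\<rho> \<in> {\<rho>. \<rho> permutes A \<and> (\<forall>i\<in>D. \<rho> i = \<pi> i)}"
    then have \<rho>: "\<rho> permutes A" "\<forall>i\<in>D. \<rho> i = \<pi> i" by auto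
    let ?\<kappa> = "inv' \<pi> \<circ> \<rho>"
    have "?\<kappa> permutes A" by (rule permutes_compose[OF \<rho>(1) permutes_inv[OF \<pi>]])
    then have "?\<kappa> permutes (A - D)"
      by (rule permutes_superset) (use \<rho>(2) permutes_inverses(2)[OF \<pi>] in auto)
    moreover have "\<rho> = \<pi> \<circ> ?\<kappa>" using permutes_inverses(1)[OF \<pi>] by auto
    ultimately show "\<rho> \<in> (\<lambda>\<kappa>. \<pi> \<circ> \<kappa>) ` {\<kappa>. \<kappa> permutes (A - D)}" by blast
  next
    fix \<rho> assume "\<rho> \<in> (\<lambda>\<kappa>. \<pi> \<circ> \<kappa>) ` {\<kappa>. \<kappa> permutes (A - D)}"
    then obtain \<kappa> where \<kappa>: "\<kappa> permutes (A - D)" "\<rho> = \<pi> \<circ> \<kappa>" by auto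
    have "\<kappa> permutes A" using \<kappa>(1) by (rule permutes_subset) auto
    then have "\<rho> permutes A" unfolding \<kappa>(2) using \<pi> by (rule permutes_compose)
    moreover have "\<rho> i = \<pi> i" if "i \<in> D" for i
      using that \<kappa> permutes_not_in[OF \<kappa>(1), of i] by auto
    ultimately show "\<rho> \<in> {\<rho>. \<rho> permutes A \<and> (\<forall>i\<in>D. \<rho> i = \<pi> i)}" by auto
  qed
  moreover have "inj_on (\<lambda>\<kappa>. \<pi> \<circ> \<kappa>) {\<kappa>. \<kappa> permutes (A - D)}"
    by (rule inj_on_subset[OF fun.inj_map[OF permutes_inj[OF \<pi>]] subset_UNIV])
  moreover have "card {\<kappa>. \<kappa> permutes (A - D)} = fact (card A - card D)"
    using A D finite_subset[OF D A] by (intro card_permutations) (auto simp: card_Diff_subset)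
  ultimately show ?thesis by (simp add: card_image)
qed

text \<open>
  For any given \<sigma> that differs from \<tau> somewhere on S, many permutations agree with \<tau> on S and with
  \<sigma> in exactly t - 1 points. If \<sigma> and \<tau> agree in e points of S, prescribe the values of \<sigma> on a set
  Q of t - 1 - e further points; this reaches t - 1 agreements. Prescribe also one wrong value
  \<sigma> r' at a point r. Then only m - 1 of the m remaining points can still produce an agreement, because r' has
  lost its value. Each of them does so in at most (m - 1)! ways, so at least
  m! - (m - 1) (m - 1)! = (m - 1)! permutations produce none. Without the wrong value, the same
  union bound would leave nothing.
\<close>
lemma many_perms_agreeing_exactly:
  assumes A: "finite A" and \<sigma>: "\<sigma> permutes A" and \<tau>: "\<tau> permutes A"
    and S: "S \<subseteq> A" "card S = t" and differ: "\<exists>i\<in>S. \<sigma> i \<noteq> \<tau> i" and big: "3 * t + 1 \<le> card A"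
  shows "fact (card A - 2 * t - 1) \<le>
    card {\<rho>. \<rho> permutes A \<and> (\<forall>i\<in>S. \<rho> i = \<tau> i) \<and> card {i \<in> A. \<rho> i = \<sigma> i} = t - 1}"
proof -
  have finS: "finite S" using A S finite_subset by auto
  define E where "E = {i \<in> S. \<tau> i = \<sigma> i}"
  have E: "E \<subset> S" "finite E" using differ finS by (force simp: E_def)+
  then have cE: "card E < t" using psubset_card_mono[OF finS E(1)] S(2) by simp
  \<comment> \<open>the points that can be used without interfering with the values of \<tau> on S\<close>
  define R0 where "R0 = {i \<in> A. i \<notin> S \<and> \<sigma> i \<notin> \<tau> ` S}"
  have finR0: "finite R0" using A by (simp add: R0_def)
  have "A \<subseteq> R0 \<union> (S \<union> inv' \<sigma> ` (\<tau> ` S))"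
  proof
    fix i assume "i \<in> A"
    show "i \<in> R0 \<union> (S \<union> inv' \<sigma> ` (\<tau> ` S))"
    proof (cases "\<sigma> i \<in> \<tau> ` S")
      case True
      then have "inv' \<sigma> (\<sigma> i) \<in> inv' \<sigma> ` (\<tau> ` S)" by blast
      then show ?thesis using permutes_inverses(2)[OF \<sigma>] by simp
    qed (use \<open>i \<in> A\<close> in \<open>auto simp: R0_def\<close>)
  qed
  then have "card A \<le> card (R0 \<union> (S \<union> inv' \<sigma> ` (\<tau> ` S)))" using finR0 finS by (intro card_mono) auto
  also have "\<dots> \<le> card R0 + (card S + card (inv' \<sigma> ` (\<tau> ` S)))"
    by (meson add_left_mono card_Un_le order_trans)
  also have "card (inv' \<sigma> ` (\<tau> ` S)) \<le> card S"
    using finS by (meson card_image_le finite_imageI order_trans)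
  finally have "t + 1 \<le> card R0" using S(2) big by linarith
  then have "t - card E + 1 \<le> card R0" by linarith
  then obtain Q' where Q': "Q' \<subseteq> R0" "card Q' = t - card E + 1" by (meson obtain_subset_with_card_n)
  have finQ': "finite Q'" using Q' finR0 finite_subset by auto
  then obtain r where r: "r \<in> Q'" using Q'(2) by (cases "Q' = {}") auto
  then have "card (Q' - {r}) = t - card E" using Q'(2) finQ' by simp
  then have "Q' - {r} \<noteq> {}" using cE by (metis card.empty less_irrefl zero_less_diff)
  then obtain r' where r': "r' \<in> Q'" "r' \<noteq> r" by auto
  define Q where "Q = Q' - {r} - {r'}"
  have Q: "Q \<subseteq> R0" "r \<in> R0" "r' \<in> R0" "r \<notin> Q" "r' \<notin> Q" "r \<noteq> r'" "finite Q"
    using Q' r r' finQ' by (auto simp: Q_def)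
  have cQ: "card Q = t - 1 - card E"
    using \<open>card (Q' - {r}) = t - card E\<close> r' finQ' by (simp add: Q_def)
  define D where "D = insert r (S \<union> Q)"
  define f where "f = (\<lambda>i. if i \<in> S then \<tau> i else if i \<in> Q then \<sigma> i else \<sigma> r')"
  have SQ: "S \<inter> Q = {}" "r \<notin> S" "r' \<notin> S" using Q by (auto simp: R0_def)
  have injs: "inj \<sigma>" "inj \<tau>" using \<sigma> \<tau> by (auto intro: permutes_inj)
  have DA: "D \<subseteq> A" using S Q by (auto simp: D_def R0_def)
  have fD: "f ` D \<subseteq> A"
    using permutes_in_image[OF \<sigma>] permutes_in_image[OF \<tau>] DA Q by (auto simp: f_def D_def R0_def)
  have fS: "f i = \<tau> i" if "i \<in> S" for i using that by (simp add: f_def)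
  have fQ: "f i = \<sigma> i" if "i \<in> Q" for i using that SQ by (auto simp: f_def)
  have fr: "f r = \<sigma> r'" using SQ Q by (auto simp: f_def)
  have "inj_on f S" by (rule inj_onI) (metis fS injD[OF injs(2)])
  moreover have "inj_on f Q" by (rule inj_onI) (metis fQ injD[OF injs(1)])
  moreover have "f ` S \<inter> f ` Q = {}" 
  proof -
    have "f i \<noteq> f j" if "i \<in> S" "j \<in> Q" for i j
    proof -
      have "\<sigma> j \<notin> \<tau> ` S" using that(2) Q(1) by (auto simp: R0_def)
      then show ?thesis using that fS[OF that(1)] fQ[OF that(2)] by (metis imageI)
    qed
    then show ?thesis by blast
  qed
  ultimately have "inj_on f (S \<union> Q)" using SQ by (auto simp: inj_on_Un)
  moreover have "f r \<notin> f ` (S \<union> Q)"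
  proof
    assume "f r \<in> f ` (S \<union> Q)"
    then obtain i where i: "i \<in> S \<union> Q" "f i = \<sigma> r'" using fr by (metis imageE)
    show False
    proof (cases "i \<in> S")
      case True
      then have "\<sigma> r' \<in> \<tau> ` S" using i(2) fS[OF True] by (metis imageI)
      then show False using Q(3) by (simp add: R0_def)
    next
      case False
      then have "\<sigma> i = \<sigma> r'" "i \<in> Q" using i fQ by auto
      then show False using injD[OF injs(1)] Q(5) by metis
    qed
  qed
  ultimately have "inj_on f D" unfolding D_def by (subst inj_on_insert) auto
  then obtain \<pi> where \<pi>: "\<pi> permutes A" "\<And>i. i \<in> D \<Longrightarrow> \<pi> i = f i"
    using permutes_extending_injection[OF A DA _ fD] by auto
  define m where "m = card A - card D"
  have finD: "finite D" using DA A finite_subset by auto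
  have cD: "card D = 2 * t - card E"
    using finS Q SQ S(2) cQ cE by (simp add: D_def card_Un_disjoint)
  have "r' \<in> A - D" using Q SQ by (auto simp: D_def R0_def)
  then have cAD: "card (A - D - {r'}) = m - 1" "m \<ge> 1"
    using DA A finD card_Diff_subset[OF finD DA] card_gt_0_iff[of "A - D"] by (auto simp: m_def)
  define P where "P = (\<lambda>D. {\<rho>. \<rho> permutes A \<and> (\<forall>i\<in>D. \<rho> i = \<pi> i)})"
  define N where "N = (\<lambda>i. {\<rho> \<in> P D. \<rho> i = \<sigma> i})"
  have finP: "finite (P D)" using A by (auto simp: P_def intro: finite_subset[OF _ finite_permutations[OF A]])
  have cP: "card (P D) = fact m" unfolding P_def m_def by (rule card_permutes_agreeing_on[OF A DA \<pi>(1)])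
  have cN: "card (N i) \<le> fact (m - 1)" if i: "i \<in> A - D - {r'}" for i
  proof (cases "N i = {}")
    case False
    then obtain \<rho> where \<rho>: "\<rho> permutes A" "\<forall>j\<in>D. \<rho> j = \<pi> j" "\<rho> i = \<sigma> i" by (auto simp: N_def P_def)
    have "N i = {\<rho>'. \<rho>' permutes A \<and> (\<forall>j\<in>insert i D. \<rho>' j = \<rho> j)}"
      using \<rho> by (auto simp: N_def P_def)
    also have "card \<dots> = fact (card A - card (insert i D))"
      using i DA by (intro card_permutes_agreeing_on[OF A _ \<rho>(1)]) auto
    also have "card A - card (insert i D) = m - 1" using i finD by (simp add: m_def)
    finally show ?thesis by simp
  qed simp
  let ?G = "{\<rho>. \<rho> permutes A \<and> (\<forall>i\<in>S. \<rho> i = \<tau> i) \<and> card {i \<in> A. \<rho> i = \<sigma> i} = t - 1}"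
  have sub: "P D - (\<Union>i\<in>A - D - {r'}. N i) \<subseteq> ?G"
  proof
    fix \<rho> assume \<rho>: "\<rho> \<in> P D - (\<Union>i\<in>A - D - {r'}. N i)"
    then have \<rho>p: "\<rho> permutes A" and \<rho>D: "\<And>i. i \<in> D \<Longrightarrow> \<rho> i = f i" using \<pi>(2) by (auto simp: P_def)
    \<comment> \<open>no agreement occurs outside the prescribed points\<close>
    have out: "\<rho> i \<noteq> \<sigma> i" if "i \<in> A - D" for i
    proof (cases "i = r'")
      case True
      have "\<rho> r = \<sigma> r'" using \<rho>D[of r] fr by (simp add: D_def)
      then show ?thesis using True Q(6) permutes_inj[OF \<rho>p] by (metis injD)
    qed (use \<rho> that in \<open>auto simp: N_def\<close>)
    have "{i \<in> A. \<rho> i = \<sigma> i} = {i \<in> D. f i = \<sigma> i}"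
      by (rule Collect_cong) (metis DiffI out \<rho>D DA subsetD)
    also have "\<dots> = E \<union> Q"
    proof -
      have "f r \<noteq> \<sigma> r" unfolding fr using Q(6) injD[OF injs(1)] by metis
      then show ?thesis using fS fQ by (auto simp: D_def E_def)
    qed
    also have "card \<dots> = card E + card Q"
      using E Q SQ by (intro card_Un_disjoint) auto
    finally have "card {i \<in> A. \<rho> i = \<sigma> i} = t - 1" using cQ cE by simp
    moreover have "\<forall>i\<in>S. \<rho> i = \<tau> i" using \<rho>D fS by (auto simp: D_def)
    ultimately show "\<rho> \<in> ?G" using \<rho>p by simp
  qed
  have "card (\<Union>i\<in>A - D - {r'}. N i) \<le> (\<Sum>i\<in>A - D - {r'}. card (N i))"
    using A by (intro card_UN_le) auto
  also have "\<dots> \<le> (\<Sum>i\<in>A - D - {r'}. fact (m - 1))" by (rule sum_mono) (use cN in auto)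
  also have "\<dots> = (m - 1) * fact (m - 1)" using cAD by simp
  finally have bad: "card (\<Union>i\<in>A - D - {r'}. N i) \<le> (m - 1) * fact (m - 1)" .
  have "fact (card A - 2 * t - 1) \<le> (fact (m - 1) :: nat)"
    using cD cE big by (intro fact_mono) (auto simp: m_def)
  also have "fact m = m * fact (m - 1)" using cAD by (simp add: fact_reduce)
  then have "fact (m - 1) \<le> fact m - (m - 1) * (fact (m - 1) :: nat)"
    by (metis cAD(2) diff_diff_cancel diff_mult_distrib mult_1 order_refl)
  also have "\<dots> \<le> card (P D) - card (\<Union>i\<in>A - D - {r'}. N i)" using bad cP by simp
  also have "\<dots> \<le> card (P D - (\<Union>i\<in>A - D - {r'}. N i))"
    by (intro diff_card_le_card_Diff) (auto simp: N_def intro: finite_subset[OF _ finP])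
  also have "\<dots> \<le> card ?G"
    using sub finite_subset[OF _ finite_permutations[OF A]] by (intro card_mono) auto
  finally show ?thesis .
qed

section \<open>Graphs of permutations\<close>

text \<open>
  Permutations are handled through their graphs, so that agreement becomes intersection and
  prescribing values becomes containment.
\<close>
definition perm_graph :: "'a set \<Rightarrow> ('a \<Rightarrow> 'a) \<Rightarrow> ('a \<times> 'a) set" where
  "perm_graph A \<sigma> = (\<lambda>i. (i, \<sigma> i)) ` A"

definition perm_graphs :: "'a set \<Rightarrow> ('a \<times> 'a) set set" where
  "perm_graphs A = perm_graph A ` {\<sigma>. \<sigma> permutes A}"

definition containing :: "'a set set \<Rightarrow> 'a set \<Rightarrow> 'a set set" where
  "containing \<G> X = {F \<in> \<G>. X \<subseteq> F}"

lemma mem_perm_graph: "(i, j) \<in> perm_graph A \<sigma> \<longleftrightarrow> i \<in> A \<and> j = \<sigma> i"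
  by (auto simp: perm_graph_def)

lemma finite_perm_graphs: "finite A \<Longrightarrow> finite (perm_graphs A)"
  by (simp add: perm_graphs_def finite_permutations)

lemma card_perm_graph: "card (perm_graph A \<sigma>) = card A"
  unfolding perm_graph_def by (rule card_image) (auto simp: inj_on_def)

lemma perm_graphs_member:
  assumes "F \<in> perm_graphs A" "finite A"
  shows "F \<subseteq> A \<times> A" "finite F" "card F = card A"
proof -
  obtain \<sigma> where \<sigma>: "\<sigma> permutes A" "F = perm_graph A \<sigma>" using assms(1) by (auto simp: perm_graphs_def)
  show "F \<subseteq> A \<times> A" using permutes_in_image[OF \<sigma>(1)] by (auto simp: \<sigma>(2) perm_graph_def)
  then show "finite F" using assms(2) finite_subset by blast
  show "card F = card A" by (simp add: \<sigma>(2) card_perm_graph)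
qed

lemma inj_on_perm_graph: "inj_on (perm_graph A) {\<sigma>. \<sigma> permutes A}"
proof (rule inj_onI, clarify)
  fix \<sigma> \<tau> assume *: "\<sigma> permutes A" "\<tau> permutes A" "perm_graph A \<sigma> = perm_graph A \<tau>"
  show "\<sigma> = \<tau>"
  proof
    fix i show "\<sigma> i = \<tau> i"
    proof (cases "i \<in> A")
      case True
      then have "(i, \<sigma> i) \<in> perm_graph A \<tau>" using *(3) mem_perm_graph by metis
      then show ?thesis by (simp add: mem_perm_graph)
    qed (use * in \<open>simp add: permutes_not_in\<close>)
  qed
qed

lemma perm_graph_Int: "perm_graph A \<sigma> \<inter> perm_graph A \<tau> = perm_graph {i \<in> A. \<sigma> i = \<tau> i} \<sigma>"
  by (auto simp: perm_graph_def)

lemma finite_containing: "finite \<G> \<Longrightarrow> finite (containing \<G> X)"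
  by (simp add: containing_def)

lemma card_containing_perm_graph:
  assumes "finite A" "D \<subseteq> A" "\<pi> permutes A"
  shows "card (containing (perm_graphs A) (perm_graph D \<pi>)) = fact (card A - card D)"
proof -
  have "containing (perm_graphs A) (perm_graph D \<pi>) =
      perm_graph A ` {\<rho>. \<rho> permutes A \<and> (\<forall>i\<in>D. \<rho> i = \<pi> i)}"
  proof -
    have "perm_graph D \<pi> \<subseteq> perm_graph A \<rho> \<longleftrightarrow> (\<forall>i\<in>D. \<rho> i = \<pi> i)" for \<rho>
      using assms(2) by (auto simp: perm_graph_def)
    then show ?thesis by (auto simp: containing_def perm_graphs_def)
  qed
  also have "card \<dots> = fact (card A - card D)"
    using card_permutes_agreeing_on[OF assms]
    by (subst card_image) (auto intro: inj_on_subset[OF inj_on_perm_graph])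
  finally show ?thesis .
qed

lemma card_containing_perm_graphs_le:
  assumes "finite A"
  shows "card (containing (perm_graphs A) X) \<le> fact (card A - card X)"
proof (cases "containing (perm_graphs A) X = {}")
  case False
  then obtain \<pi> where \<pi>: "\<pi> permutes A" "X \<subseteq> perm_graph A \<pi>"
    by (auto simp: containing_def perm_graphs_def)
  then obtain D where D: "D \<subseteq> A" "X = perm_graph D \<pi>"
    unfolding perm_graph_def by (meson subset_imageE)
  show ?thesis unfolding D(2) card_containing_perm_graph[OF assms D(1) \<pi>(1)] card_perm_graph ..
qed simp

text \<open>
  There are at most g^|I| ways to choose the values on I, and each choice extends to at most
  (|A| - |I|)! permutations.
\<close>
lemma card_perm_graphs_confined:
  assumes A: "finite A" and I: "I \<subseteq> A" and g: "\<And>i. i \<in> I \<Longrightarrow> G i \<subseteq> A \<and> card (G i) \<le> g"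
  shows "card {F \<in> perm_graphs A. \<forall>i\<in>I. \<forall>j. (i, j) \<in> F \<longrightarrow> j \<in> G i} \<le> g ^ card I * fact (card A - card I)"
proof -
  have finI: "finite I" and finG: "\<And>i. i \<in> I \<Longrightarrow> finite (G i)" using A I g by (auto intro: finite_subset)
  have "{F \<in> perm_graphs A. \<forall>i\<in>I. \<forall>j. (i, j) \<in> F \<longrightarrow> j \<in> G i} \<subseteq>
      (\<Union>f\<in>Pi\<^sub>E I G. containing (perm_graphs A) (perm_graph I f))"
  proof
    fix F assume F: "F \<in> {F \<in> perm_graphs A. \<forall>i\<in>I. \<forall>j. (i, j) \<in> F \<longrightarrow> j \<in> G i}"
    then obtain \<sigma> where \<sigma>: "F = perm_graph A \<sigma>" by (auto simp: perm_graphs_def)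
    have "restrict \<sigma> I \<in> Pi\<^sub>E I G" using F I by (auto simp: \<sigma> mem_perm_graph)
    moreover have "perm_graph I (restrict \<sigma> I) \<subseteq> F" using I by (auto simp: \<sigma> perm_graph_def)
    ultimately show "F \<in> (\<Union>f\<in>Pi\<^sub>E I G. containing (perm_graphs A) (perm_graph I f))"
      using F unfolding containing_def by blast
  qed
  moreover have "finite (Pi\<^sub>E I G)" using finI finG by (rule finite_PiE)
  ultimately have "card {F \<in> perm_graphs A. \<forall>i\<in>I. \<forall>j. (i, j) \<in> F \<longrightarrow> j \<in> G i} \<le>
      card (\<Union>f\<in>Pi\<^sub>E I G. containing (perm_graphs A) (perm_graph I f))"
    using finite_containing[OF finite_perm_graphs[OF A]] by (intro card_mono) auto
  also have "\<dots> \<le> (\<Sum>f\<in>Pi\<^sub>E I G. card (containing (perm_graphs A) (perm_graph I f)))"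
    using \<open>finite (Pi\<^sub>E I G)\<close> by (rule card_UN_le)
  also have "\<dots> \<le> (\<Sum>f\<in>Pi\<^sub>E I G. fact (card A - card I))"
    by (rule sum_mono) (metis card_containing_perm_graphs_le[OF A] card_perm_graph)
  also have "\<dots> = (\<Prod>i\<in>I. card (G i)) * fact (card A - card I)" using finI by (simp add: card_PiE)
  also have "(\<Prod>i\<in>I. card (G i)) \<le> (\<Prod>i\<in>I. g)" using g by (intro prod_mono) auto
  finally show ?thesis by simp
qed

lemma power_mult_fact_le: "m ^ r * fact m \<le> (fact (m + r) :: nat)"
proof (induction r)
  case (Suc r)
  have "m ^ Suc r * fact m = m * (m ^ r * fact m)" by simp
  also have "\<dots> \<le> (m + Suc r) * fact (m + r)" using Suc by (intro mult_mono) auto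
  finally show ?case by simp
qed simp

text \<open>
  An average cell lies on a 1 / n fraction of \<G>. A cell counts as dense if it reaches a
  1 / (2 r) part of this average. With this threshold, the sparse cells of r rows together
  lie on at most half of \<G>.
\<close>
definition dense_cell :: "nat \<Rightarrow> nat \<Rightarrow> ('a \<times> 'a) set set \<Rightarrow> 'a \<Rightarrow> 'a \<Rightarrow> bool" where
  "dense_cell n r \<G> i j \<longleftrightarrow> card \<G> \<le> 2 * r * n * card (containing \<G> {(i, j)})"

text \<open>
  Suppose that r rows have at most n / 2 dense cells each. At least half of \<G> uses only dense
  cells in these rows. But only (n / 2)^r (n - r)! permutations do so, whereas
  n! \<ge> (n - r)^r (n - r)!. Since n - r \<ge> 3 n / 4, this is a fraction (2/3)^r of all
  permutations, too small for a family with at least n! / D members.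
\<close>
lemma few_sparse_rows:
  assumes A: "finite A" "card A = n" and \<G>: "\<G> \<subseteq> perm_graphs A" and D: "fact n \<le> D * real (card \<G>)"
    and r: "4 * r \<le> n" "r \<ge> 1" and small: "2 * D * (2/3) ^ r < 1"
  shows "card {i \<in> A. 2 * card {j \<in> A. dense_cell n r \<G> i j} \<le> n} < r"
proof (rule ccontr)
  assume "\<not> ?thesis"
  then obtain I where I: "I \<subseteq> {i \<in> A. 2 * card {j \<in> A. dense_cell n r \<G> i j} \<le> n}" "card I = r"
    by (meson linorder_not_less obtain_subset_with_card_n)
  then have IA: "I \<subseteq> A" by auto
  then have finI: "finite I" using A finite_subset by auto
  have fin\<G>: "finite \<G>" using \<G> finite_perm_graphs[OF A(1)] finite_subset by auto
  define G where "G = (\<lambda>i. {j \<in> A. dense_cell n r \<G> i j})"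
  define \<H> where "\<H> = {F \<in> \<G>. \<forall>i\<in>I. \<forall>j. (i, j) \<in> F \<longrightarrow> j \<in> G i}"
  define Z where "Z = {z \<in> I \<times> A. \<not> dense_cell n r \<G> (fst z) (snd z)}"
  have Z: "finite Z" "card Z \<le> r * n"
  proof -
    have "card Z \<le> card (I \<times> A)" using finI A by (intro card_mono) (auto simp: Z_def)
    then show "card Z \<le> r * n" using I A by (simp add: card_cartesian_product)
    show "finite Z" using finI A by (simp add: Z_def)
  qed
  have "\<G> - \<H> \<subseteq> (\<Union>z\<in>Z. containing \<G> {z})"
  proof
    fix F assume F: "F \<in> \<G> - \<H>"
    then obtain i j where ij: "i \<in> I" "(i, j) \<in> F" "j \<notin> G i" by (auto simp: \<H>_def)
    have "j \<in> A" using perm_graphs_member(1)[of F A] F \<G> A ij by auto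
    then have "(i, j) \<in> Z" using ij by (auto simp: Z_def G_def)
    then show "F \<in> (\<Union>z\<in>Z. containing \<G> {z})" using F ij by (auto simp: containing_def)
  qed
  then have "card (\<G> - \<H>) \<le> card (\<Union>z\<in>Z. containing \<G> {z})"
    using Z finite_containing[OF fin\<G>] by (intro card_mono) auto
  also have "\<dots> \<le> (\<Sum>z\<in>Z. card (containing \<G> {z}))" using Z by (intro card_UN_le)
  finally have "2 * r * n * card (\<G> - \<H>) \<le> (\<Sum>z\<in>Z. 2 * r * n * card (containing \<G> {z}))"
    by (simp add: sum_distrib_left[symmetric])
  also have "\<dots> \<le> (\<Sum>z\<in>Z. card \<G>)"
    by (rule sum_mono) (auto simp: Z_def dense_cell_def)
  also have "\<dots> \<le> r * n * card \<G>" using Z by simp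
  finally have "r * n * (2 * card (\<G> - \<H>)) \<le> r * n * card \<G>" by (simp add: mult_ac)
  then have "2 * card (\<G> - \<H>) \<le> card \<G>" using r by simp
  moreover have "card (\<G> - \<H>) = card \<G> - card \<H>"
    using fin\<G> by (intro card_Diff_subset) (auto simp: \<H>_def intro: finite_subset)
  moreover have "card \<H> \<le> card \<G>" using fin\<G> by (intro card_mono) (auto simp: \<H>_def)
  ultimately have "card \<G> \<le> 2 * card \<H>" by linarith
  also have "card \<H> \<le> card {F \<in> perm_graphs A. \<forall>i\<in>I. \<forall>j. (i, j) \<in> F \<longrightarrow> j \<in> G i}"
    using \<G> finite_perm_graphs[OF A(1)] by (intro card_mono) (auto simp: \<H>_def)
  also have "\<dots> \<le> (n div 2) ^ card I * fact (card A - card I)"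
    by (rule card_perm_graphs_confined) (use A IA I in \<open>auto simp: G_def\<close>)
  finally have "card \<G> \<le> 2 * ((n div 2) ^ r * fact (n - r))" using A I by simp
  then have "real (card \<G>) \<le> real (2 * ((n div 2) ^ r * fact (n - r)))" by (rule of_nat_mono)
  also have "\<dots> = 2 * (real (n div 2) ^ r * fact (n - r))" by simp
  also have "real (n div 2) \<le> 2/3 * real (n - r)" using r by linarith
  then have "real (n div 2) ^ r \<le> (2/3 * real (n - r)) ^ r" by (intro power_mono) auto
  also have "\<dots> = (2/3) ^ r * real (n - r) ^ r" by (rule power_mult_distrib)
  finally have "real (card \<G>) \<le> 2 * ((2/3) ^ r * (real (n - r) ^ r * fact (n - r)))"
    by (simp add: mult_ac mult_right_mono)
  also have "real (n - r) ^ r * fact (n - r) \<le> fact n"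
  proof -
    have "(n - r) ^ r * fact (n - r) \<le> (fact n :: nat)" using power_mult_fact_le[of "n - r" r] r by simp
    then have "real ((n - r) ^ r * fact (n - r)) \<le> real (fact n)" by (rule of_nat_mono)
    then show ?thesis by simp
  qed
  finally have le: "real (card \<G>) \<le> 2 * (2/3) ^ r * fact n" by simp
  have "0 < D"
  proof (rule ccontr)
    assume "\<not> 0 < D"
    then have "D * real (card \<G>) \<le> 0" by (simp add: mult_nonpos_nonneg)
    then show False using D fact_gt_zero[of n, where 'a = real] by linarith
  qed
  then have "D * real (card \<G>) \<le> D * (2 * (2/3) ^ r * fact n)" using le by (intro mult_left_mono) auto
  also have "\<dots> = 2 * D * (2/3) ^ r * fact n" by simp
  also have "\<dots> < 1 * fact n" using small by (intro mult_strict_right_mono) auto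
  finally show False using D by simp
qed

section \<open>Spread families\<close>

text \<open>
  With K = 1 this is R-spreadness of the link of B in \<G>. The constant K absorbs the loss that occurs when
  the family is restricted to a cell, so that R remains the same throughout.
\<close>
definition spread :: "real \<Rightarrow> real \<Rightarrow> 'a set set \<Rightarrow> 'a set \<Rightarrow> bool" where
  "spread K R \<G> B \<longleftrightarrow> (\<forall>F\<in>\<G>. B \<subseteq> F) \<and>
    (\<forall>X. B \<subseteq> X \<longrightarrow> real (card (containing \<G> X)) * R ^ card (X - B) \<le> K * real (card \<G>))"

lemma spreadD:
  assumes "spread K R \<G> B"
  shows "F \<in> \<G> \<Longrightarrow> B \<subseteq> F"
    and "B \<subseteq> X \<Longrightarrow> real (card (containing \<G> X)) * R ^ card (X - B) \<le> K * real (card \<G>)"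
  using assms by (auto simp: spread_def)

text \<open>
  If z lies on a fraction of \<G> that is smaller than the critical 1 / R only by a factor L, then
  restricting to z costs no more than the factor L in the constant.
\<close>
lemma spread_restrict_to_cell:
  assumes fin: "\<And>F. F \<in> \<G> \<Longrightarrow> finite F" and sp: "spread K R \<G> B" and z: "z \<notin> B"
    and R: "R > 0" and K: "K \<ge> 0" and L: "0 \<le> L"
    and dense: "real (card \<G>) \<le> L * R * real (card (containing \<G> {z}))"
  shows "spread (K * L) R (containing \<G> {z}) (insert z B)"
  unfolding spread_def
proof (intro conjI ballI allI impI)
  fix F assume "F \<in> containing \<G> {z}"
  then show "insert z B \<subseteq> F" using spreadD(1)[OF sp] by (auto simp: containing_def)
next
  fix X assume X: "insert z B \<subseteq> X"
  have eq: "containing (containing \<G> {z}) X = containing \<G> X" using X by (auto simp: containing_def)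
  show "real (card (containing (containing \<G> {z}) X)) * R ^ card (X - insert z B) \<le>
    K * L * real (card (containing \<G> {z}))"
  proof (cases "finite X")
    case True
    have e: "X - B = insert z (X - insert z B)" using X z by auto
    have "card (X - B) = Suc (card (X - insert z B))" using True arg_cong[OF e, of card] by simp
    then have "R * (real (card (containing \<G> X)) * R ^ card (X - insert z B)) =
        real (card (containing \<G> X)) * R ^ card (X - B)" by simp
    also have "\<dots> \<le> K * real (card \<G>)" using X by (intro spreadD(2)[OF sp]) auto
    also have "\<dots> \<le> K * (L * R * real (card (containing \<G> {z})))" using dense K by (intro mult_left_mono)
    also have "\<dots> = R * (K * L * real (card (containing \<G> {z})))" by simp
    finally show ?thesis using R by (simp add: eq)
  next
    case False
    then have "containing \<G> X = {}" using fin finite_subset by (auto simp: containing_def)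
    then show ?thesis using K L by (simp add: eq)
  qed
qed

lemma card_pos_if_fact_le:
  assumes "fact n \<le> D * real (card \<G>)"
  shows "card \<G> > 0"
proof (rule ccontr)
  assume "\<not> ?thesis"
  then have "fact n \<le> (0 :: real)" using assms by simp
  then show False using fact_gt_zero[of n, where 'a = real] by linarith
qed

text \<open>
  Fewer than 2 r rows are sparse for one of the two families. In any other row both families have
  more than n / 2 dense cells, so they share one. It cannot belong to B1 or B2: in a
  row that meets B1 all members of \<G>1 use the same cell, so only one cell there is dense.
\<close>
lemma common_dense_cell:
  assumes A: "finite A" "card A = n" and r: "4 * r \<le> n" "r \<ge> 1"
    and \<G>: "\<G>1 \<subseteq> perm_graphs A" "\<G>2 \<subseteq> perm_graphs A"
    and D: "fact n \<le> D * real (card \<G>1)" "fact n \<le> D * real (card \<G>2)"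
    and small: "2 * D * (2/3) ^ r < 1"
    and B: "\<And>F. F \<in> \<G>1 \<Longrightarrow> B1 \<subseteq> F" "\<And>F. F \<in> \<G>2 \<Longrightarrow> B2 \<subseteq> F"
  shows "\<exists>z. z \<notin> B1 \<and> z \<notin> B2 \<and> card \<G>1 \<le> 2 * r * n * card (containing \<G>1 {z}) \<and>
    card \<G>2 \<le> 2 * r * n * card (containing \<G>2 {z})"
proof -
  define J where "J = (\<lambda>\<G> i. {j \<in> A. dense_cell n r \<G> i j})"
  define I where "I = (\<lambda>\<G>. {i \<in> A. 2 * card (J \<G> i) \<le> n})"
  have "card (I \<G>1) < r" "card (I \<G>2) < r"
    unfolding I_def J_def using few_sparse_rows[OF A _ _ r small] \<G> D by blast+
  then have "card (I \<G>1 \<union> I \<G>2) < card A"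
    using card_Un_le[of "I \<G>1" "I \<G>2"] r A by linarith
  moreover have "finite (I \<G>1 \<union> I \<G>2)" using A by (simp add: I_def)
  ultimately have "\<not> A \<subseteq> I \<G>1 \<union> I \<G>2" by (meson card_mono linorder_not_less)
  then obtain i where "i \<in> A" "i \<notin> I \<G>1" "i \<notin> I \<G>2" by auto
  then have i: "i \<in> A" "n < 2 * card (J \<G>1 i)" "n < 2 * card (J \<G>2 i)"
    by (auto simp: I_def)
  have finJ: "finite (J \<G> i)" "J \<G> i \<subseteq> A" for \<G> using A by (auto simp: J_def)
  have "J \<G>1 i \<inter> J \<G>2 i \<noteq> {}"
  proof
    assume "J \<G>1 i \<inter> J \<G>2 i = {}"
    then have "card (J \<G>1 i) + card (J \<G>2 i) = card (J \<G>1 i \<union> J \<G>2 i)"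
      using finJ by (simp add: card_Un_disjoint)
    also have "\<dots> \<le> card A" using finJ A by (intro card_mono) auto
    finally show False using i A by linarith
  qed
  then obtain j where j: "j \<in> J \<G>1 i" "j \<in> J \<G>2 i" by auto
  have notin: "(i, j) \<notin> B"
    if H: "\<H> \<subseteq> perm_graphs A" "fact n \<le> D * real (card \<H>)" "\<And>F. F \<in> \<H> \<Longrightarrow> B \<subseteq> F" "n < 2 * card (J \<H> i)" for \<H> B
  proof
    assume ij: "(i, j) \<in> B"
    have pos: "card \<H> > 0" by (rule card_pos_if_fact_le[OF H(2)])
    have "J \<H> i \<subseteq> {j}"
    proof
      fix j' assume j': "j' \<in> J \<H> i"
      then have "containing \<H> {(i, j')} \<noteq> {}"
        using pos by (auto simp: J_def dense_cell_def)
      then obtain F where F: "F \<in> \<H>" "(i, j') \<in> F" by (auto simp: containing_def)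
      moreover have "(i, j) \<in> F" using F H(3) ij by blast
      moreover obtain \<sigma> where "F = perm_graph A \<sigma>" using F H(1) by (auto simp: perm_graphs_def)
      ultimately show "j' \<in> {j}" by (simp add: mem_perm_graph)
    qed
    then have "card (J \<H> i) \<le> 1" using card_mono[of "{j}" "J \<H> i"] by simp
    then show False using H(4) r by linarith
  qed
  have "(i, j) \<notin> B1" "(i, j) \<notin> B2"
    using notin[OF \<G>(1) D(1) B(1) i(2)] notin[OF \<G>(2) D(2) B(2) i(3)] by auto
  then show ?thesis using j by (auto simp: J_def dense_cell_def)
qed

text \<open>
  Each element of C lies on at most a fraction K / R of \<G>.
\<close>
lemma spread_family_avoiding:
  assumes fin: "finite \<G>" and C: "finite C" "C \<inter> B = {}" "card C \<le> b"
    and sp: "spread K R \<G> B" and R: "R > 0" "2 * real b * K \<le> R" and K: "K \<ge> 0"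
  shows "real (card \<G>) \<le> 2 * real (card {F \<in> \<G>. F \<inter> C = {}})"
proof -
  let ?\<H> = "{F \<in> \<G>. F \<inter> C = {}}"
  have "\<G> - ?\<H> \<subseteq> (\<Union>z\<in>C. containing \<G> (insert z B))"
    using spreadD(1)[OF sp] by (auto simp: containing_def)
  then have "card (\<G> - ?\<H>) \<le> card (\<Union>z\<in>C. containing \<G> (insert z B))"
    using C finite_containing[OF fin] by (intro card_mono) auto
  also have "\<dots> \<le> (\<Sum>z\<in>C. card (containing \<G> (insert z B)))" using C by (intro card_UN_le)
  finally have "real (card (\<G> - ?\<H>)) \<le> (\<Sum>z\<in>C. real (card (containing \<G> (insert z B))))"
    by (simp only: of_nat_sum[symmetric] of_nat_le_iff)
  also have "\<dots> \<le> (\<Sum>z\<in>C. K * real (card \<G>) / R)"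
  proof (rule sum_mono)
    fix z assume "z \<in> C"
    then have "insert z B - B = {z}" using C by auto
    then show "real (card (containing \<G> (insert z B))) \<le> K * real (card \<G>) / R"
      using spreadD(2)[OF sp, of "insert z B"] R by (auto simp: field_simps)
  qed
  also have "\<dots> = real (card C) * (K * real (card \<G>) / R)" by simp
  also have "\<dots> \<le> real b * (K * real (card \<G>) / R)" using C K R by (intro mult_right_mono) auto
  also have "\<dots> = (2 * real b * K) * (real (card \<G>) / (2 * R))" by simp
  also have "\<dots> \<le> R * (real (card \<G>) / (2 * R))" using R by (intro mult_right_mono) auto
  also have "\<dots> = real (card \<G>) / 2" using R by simp
  finally have "real (card (\<G> - ?\<H>)) \<le> real (card \<G>) / 2" .
  moreover have "card \<G> = card ?\<H> + card (\<G> - ?\<H>)"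
    using fin by (subst card_Un_disjoint[symmetric]) (auto intro!: arg_cong[where f = card])
  ultimately show ?thesis by simp
qed

text \<open>
  A cover of the sets F - B must account for all of \<H>, and by spreadness a set T in the cover accounts
  for at most a fraction K (1 / R)^|T| of \<G>. The factor 2 is the loss in passing from
  \<G> to \<H>.
\<close>
lemma spread_cover_cost:
  assumes V: "finite V" and \<H>: "\<H> \<subseteq> \<G>" "finite \<G>" "\<H> \<noteq> {}" "real (card \<G>) \<le> 2 * real (card \<H>)"
    and sp: "spread K R \<G> B" and R: "R > 0" and K: "K > 0"
    and U: "U \<subseteq> Pow V" "\<And>S. S \<in> (\<lambda>F. F - B) ` \<H> \<Longrightarrow> \<exists>T\<in>U. T \<subseteq> S"
  shows "1 / (2 * K) \<le> (\<Sum>T\<in>U. (1 / R) ^ card T)"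
proof -
  have finU: "finite U" using finite_subset[OF U(1)] V by simp
  have fin\<H>: "finite \<H>" using \<H> finite_subset by auto
  define U' where "U' = {T \<in> U. T \<inter> B = {}}"
  have "\<H> \<subseteq> (\<Union>T\<in>U'. containing \<G> (B \<union> T))"
  proof
    fix F assume F: "F \<in> \<H>"
    then obtain T where "T \<in> U" "T \<subseteq> F - B" using U(2) by blast
    moreover have "B \<subseteq> F" using F \<H> spreadD(1)[OF sp] by auto
    ultimately show "F \<in> (\<Union>T\<in>U'. containing \<G> (B \<union> T))"
      using F \<H> unfolding containing_def U'_def by blast
  qed
  then have "card \<H> \<le> card (\<Union>T\<in>U'. containing \<G> (B \<union> T))"
    using finU finite_containing[OF \<H>(2)] by (intro card_mono) (auto simp: U'_def)
  also have "\<dots> \<le> (\<Sum>T\<in>U'. card (containing \<G> (B \<union> T)))" using finU by (intro card_UN_le) (simp add: U'_def)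
  finally have "real (card \<H>) \<le> (\<Sum>T\<in>U'. real (card (containing \<G> (B \<union> T))))"
    by (simp only: of_nat_sum[symmetric] of_nat_le_iff)
  also have "\<dots> \<le> (\<Sum>T\<in>U'. K * real (card \<G>) * (1 / R) ^ card T)"
  proof (rule sum_mono)
    fix T assume "T \<in> U'"
    then have "B \<union> T - B = T" by (auto simp: U'_def)
    then show "real (card (containing \<G> (B \<union> T))) \<le> K * real (card \<G>) * (1 / R) ^ card T"
      using spreadD(2)[OF sp, of "B \<union> T"] R by (auto simp: field_simps)
  qed
  also have "\<dots> = K * real (card \<G>) * (\<Sum>T\<in>U'. (1 / R) ^ card T)" by (simp add: sum_distrib_left)
  also have "\<dots> \<le> K * real (card \<G>) * (\<Sum>T\<in>U. (1 / R) ^ card T)"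
    using finU R K by (intro mult_left_mono sum_mono2) (auto simp: U'_def)
  also have "\<dots> \<le> K * (2 * real (card \<H>)) * (\<Sum>T\<in>U. (1 / R) ^ card T)"
    using \<H>(4) K R by (intro mult_right_mono mult_left_mono sum_nonneg) auto
  finally have "real (card \<H>) * 1 \<le> real (card \<H>) * (2 * K * (\<Sum>T\<in>U. (1 / R) ^ card T))"
    by (simp add: mult_ac)
  moreover have "real (card \<H>) > 0" using \<H>(3) fin\<H> by (simp add: card_gt_0_iff)
  ultimately have "1 \<le> 2 * K * (\<Sum>T\<in>U. (1 / R) ^ card T)" by (simp only: mult_le_cancel_left_pos)
  then show ?thesis using K by (simp add: field_simps)
qed

text \<open>
  Discard the members of \<G>1 that meet B2 - B1 and the members of \<G>2 that meet B1 - B2. What is left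
  of either family still has only costly covers outside its core, so there are two members
  that are disjoint outside their cores.
\<close>
lemma spread_families_meet_minimally:
  assumes V: "finite V" and \<G>: "\<G>1 \<subseteq> Pow V" "\<G>2 \<subseteq> Pow V" "\<G>1 \<noteq> {}" "\<G>2 \<noteq> {}"
    and size: "\<And>F. F \<in> \<G>1 \<union> \<G>2 \<Longrightarrow> card F < 2 ^ M" and M: "M \<ge> 1"
    and sp: "spread K R \<G>1 B1" "spread K R \<G>2 B2"
    and B: "card B1 \<le> b" "card B2 \<le> b"
    and K: "K > 0" and R: "8 * real M \<le> R" "2 * real b * K \<le> R" "32 * K * real M ^ 2 < R"
  shows "\<exists>F1\<in>\<G>1. \<exists>F2\<in>\<G>2. F1 \<inter> F2 = B1 \<inter> B2"
proof -
  have R0: "R > 0" using R(1) M by linarith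
  have fin: "finite \<G>1" "finite \<G>2" using V \<G> by (auto intro: finite_subset)
  have BV: "B1 \<subseteq> V" "B2 \<subseteq> V" using spreadD(1)[OF sp(1)] spreadD(1)[OF sp(2)] \<G> by blast+
  then have finB: "finite B1" "finite B2" using V finite_subset by auto
  define \<H>1 where "\<H>1 = {F \<in> \<G>1. F \<inter> (B2 - B1) = {}}"
  define \<H>2 where "\<H>2 = {F \<in> \<G>2. F \<inter> (B1 - B2) = {}}"
  have cB: "card (B2 - B1) \<le> b" "card (B1 - B2) \<le> b"
    using B finB by (meson card_mono Diff_subset order_trans)+
  have h1: "real (card \<G>1) \<le> 2 * real (card \<H>1)"
    unfolding \<H>1_def by (rule spread_family_avoiding[OF fin(1) _ _ cB(1) sp(1) R0 R(2)]) (use finB K in auto)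
  have h2: "real (card \<G>2) \<le> 2 * real (card \<H>2)"
    unfolding \<H>2_def by (rule spread_family_avoiding[OF fin(2) _ _ cB(2) sp(2) R0 R(2)]) (use finB K in auto)
  have ne: "\<H>1 \<noteq> {}" "\<H>2 \<noteq> {}" using h1 h2 fin \<G> by (auto simp: card_gt_0_iff)
  have sub: "\<H>1 \<subseteq> \<G>1" "\<H>2 \<subseteq> \<G>2" by (auto simp: \<H>1_def \<H>2_def)
  have finF: "finite F" if "F \<in> \<G>1 \<union> \<G>2" for F
    by (rule finite_subset[OF _ V]) (use that \<G> in blast)
  have small: "card (F - B) < 2 ^ M" if "F \<in> \<G>1 \<union> \<G>2" for F B
    using size[OF that] card_mono[OF finF[OF that], of "F - B"] by auto
  have R': "16 * real M ^ 2 / R < 1 / (2 * K)" using R(3) R0 K by (simp add: field_simps)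
  have "\<exists>S1\<in>(\<lambda>F. F - B1) ` \<H>1. \<exists>S2\<in>(\<lambda>F. F - B2) ` \<H>2. S1 \<inter> S2 = {}"
  proof (rule disjoint_members_if_covers_costly[OF V M R(1) R'])
    show "(\<lambda>F. F - B1) ` \<H>1 \<subseteq> Pow V" "(\<lambda>F. F - B2) ` \<H>2 \<subseteq> Pow V" using \<G> sub by auto
    show "card S < 2 ^ M" if "S \<in> (\<lambda>F. F - B1) ` \<H>1" for S using that sub small by auto
    show "card S < 2 ^ M" if "S \<in> (\<lambda>F. F - B2) ` \<H>2" for S using that sub small by auto
    show "1 / (2 * K) \<le> (\<Sum>T\<in>U. (1 / R) ^ card T)"
      if "U \<subseteq> Pow V" "\<And>S. S \<in> (\<lambda>F. F - B1) ` \<H>1 \<Longrightarrow> \<exists>T\<in>U. T \<subseteq> S" for U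
      by (rule spread_cover_cost[OF V sub(1) fin(1) ne(1) h1 sp(1) R0 K that])
    show "1 / (2 * K) \<le> (\<Sum>T\<in>U. (1 / R) ^ card T)"
      if "U \<subseteq> Pow V" "\<And>S. S \<in> (\<lambda>F. F - B2) ` \<H>2 \<Longrightarrow> \<exists>T\<in>U. T \<subseteq> S" for U
      by (rule spread_cover_cost[OF V sub(2) fin(2) ne(2) h2 sp(2) R0 K that])
  qed
  then obtain F1 F2 where F: "F1 \<in> \<H>1" "F2 \<in> \<H>2" "(F1 - B1) \<inter> (F2 - B2) = {}" by blast
  have "B1 \<subseteq> F1" by (rule spreadD(1)[OF sp(1)]) (use F sub in blast)
  moreover have "B2 \<subseteq> F2" by (rule spreadD(1)[OF sp(2)]) (use F sub in blast)
  moreover have "F1 \<inter> (B2 - B1) = {}" "F2 \<inter> (B1 - B2) = {}" using F by (auto simp: \<H>1_def \<H>2_def)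
  ultimately have "F1 \<inter> F2 = B1 \<inter> B2" using F(3) by auto
  then show ?thesis using F(1,2) sub by (meson subsetD)
qed

text \<open>
  A common dense cell is added to both cores m times. Each time, the intersection of the cores grows by
  one, the constant K by a factor L, and the bound D on the inverse density by a factor
  2 r n. The parameters Kmax, Dmax and b bound what is reached after m steps.
\<close>
lemma spread_families_prescribed_intersection:
  assumes A: "finite A" "card A = n" and r: "4 * r \<le> n" "r \<ge> 1"
    and M: "M \<ge> 1" "n < 2 ^ M" and R: "8 * real M \<le> R" "2 * real b * Kmax \<le> R" "32 * Kmax * real M ^ 2 < R"
    and small: "2 * Dmax * (2/3) ^ r < 1" and L: "L > 0" "2 * real r * real n \<le> L * R"
  shows "\<G>1 \<subseteq> perm_graphs A \<Longrightarrow> \<G>2 \<subseteq> perm_graphs A \<Longrightarrow>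
    fact n \<le> D * real (card \<G>1) \<Longrightarrow> fact n \<le> D * real (card \<G>2) \<Longrightarrow>
    spread K R \<G>1 B1 \<Longrightarrow> spread K R \<G>2 B2 \<Longrightarrow> K > 0 \<Longrightarrow>
    card B1 + m \<le> b \<Longrightarrow> card B2 + m \<le> b \<Longrightarrow>
    K * L ^ m \<le> Kmax \<Longrightarrow> D * (2 * real r * real n) ^ m \<le> Dmax \<Longrightarrow>
    \<exists>F1\<in>\<G>1. \<exists>F2\<in>\<G>2. card (F1 \<inter> F2) = card (B1 \<inter> B2) + m"
proof (induction m arbitrary: \<G>1 \<G>2 B1 B2 K D)
  case 0
  have V: "finite (A \<times> A)" using A by simp
  have mem: "F \<subseteq> A \<times> A" "card F < 2 ^ M" if "F \<in> \<G>1 \<union> \<G>2" for F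
    using perm_graphs_member[of F A] that 0(1,2) A M by auto
  have ne: "\<G>1 \<noteq> {}" "\<G>2 \<noteq> {}" using card_pos_if_fact_le[OF 0(3)] card_pos_if_fact_le[OF 0(4)] by auto
  have K: "2 * real b * K \<le> R" "32 * K * real M ^ 2 < R"
  proof -
    have "2 * real b * K \<le> 2 * real b * Kmax" using 0 by (intro mult_left_mono) auto
    then show "2 * real b * K \<le> R" using R by linarith
    have "32 * K * real M ^ 2 \<le> 32 * Kmax * real M ^ 2" using 0 by (intro mult_right_mono) auto
    then show "32 * K * real M ^ 2 < R" using R by linarith
  qed
  have "\<exists>F1\<in>\<G>1. \<exists>F2\<in>\<G>2. F1 \<inter> F2 = B1 \<inter> B2"
    by (rule spread_families_meet_minimally[OF V _ _ ne mem(2) M(1) 0(5,6) _ _ 0(7) R(1) K])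
      (use mem 0 in auto)
  then show ?case unfolding add_0_right by metis
next
  case (Suc m)
  have n: "real r * real n \<ge> 1"
  proof -
    have "1 * 1 \<le> real r * real n" using r by (intro mult_mono) auto
    then show ?thesis by simp
  qed
  have R0: "R > 0" using R(1) M by linarith
  have pos: "real (card \<G>1) > 0" using card_pos_if_fact_le[OF Suc.prems(3)] by simp
  have D0: "D > 0"
  proof (rule ccontr)
    assume "\<not> D > 0"
    then have "D * real (card \<G>1) \<le> 0" using pos by (simp add: mult_nonpos_nonneg)
    then show False using Suc.prems(3) fact_gt_zero[of n, where 'a = real] by linarith
  qed
  have "1 \<le> (2 * real r * real n) ^ Suc m" using n by (intro one_le_power) auto
  then have "D * 1 \<le> D * (2 * real r * real n) ^ Suc m" using D0 by (intro mult_left_mono) auto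
  then have "D \<le> Dmax" using Suc.prems(11) by linarith
  then have "2 * D * (2/3) ^ r \<le> 2 * Dmax * (2/3) ^ r" by (intro mult_right_mono) auto
  then have sD: "2 * D * (2/3) ^ r < 1" using small by linarith
  obtain z where z: "z \<notin> B1" "z \<notin> B2" and d: "card \<G>1 \<le> 2 * r * n * card (containing \<G>1 {z})"
      "card \<G>2 \<le> 2 * r * n * card (containing \<G>2 {z})"
    using common_dense_cell[OF A r Suc.prems(1-4) sD, of B1 B2]
      spreadD(1)[OF Suc.prems(5)] spreadD(1)[OF Suc.prems(6)] by blast
  have d': "real (card \<G>) \<le> 2 * real r * real n * real (card (containing \<G> {z}))"
    if "card \<G> \<le> 2 * r * n * card (containing \<G> {z})" for \<G>
    using of_nat_mono[OF that, where 'a = real] by simp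
  have dL: "real (card \<G>) \<le> L * R * real (card (containing \<G> {z}))"
    if "card \<G> \<le> 2 * r * n * card (containing \<G> {z})" for \<G>
    using d'[OF that] mult_right_mono[OF L(2), of "real (card (containing \<G> {z}))"] by linarith
  have dD: "fact n \<le> D * (2 * real r * real n) * real (card (containing \<G> {z}))"
    if "card \<G> \<le> 2 * r * n * card (containing \<G> {z})" "fact n \<le> D * real (card \<G>)" for \<G>
  proof -
    have "D * real (card \<G>) \<le> D * (2 * real r * real n * real (card (containing \<G> {z})))"
      using d'[OF that(1)] D0 by (intro mult_left_mono) auto
    also have "\<dots> = D * (2 * real r * real n) * real (card (containing \<G> {z}))" by (simp only: mult.assoc)
    finally show ?thesis using that(2) by linarith
  qed
  have finF: "finite F" if "F \<in> \<G>1 \<union> \<G>2" for F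
    using perm_graphs_member(2)[of F A] that Suc.prems(1,2) A by auto
  have finB: "finite B1" "finite B2"
  proof -
    have "\<G>1 \<noteq> {}" "\<G>2 \<noteq> {}" using card_pos_if_fact_le[OF Suc.prems(3)] card_pos_if_fact_le[OF Suc.prems(4)] by auto
    then obtain F1 F2 where F: "F1 \<in> \<G>1" "F2 \<in> \<G>2" by auto
    show "finite B1" using spreadD(1)[OF Suc.prems(5) F(1)] finF[of F1] F by (auto intro: finite_subset)
    show "finite B2" using spreadD(1)[OF Suc.prems(6) F(2)] finF[of F2] F by (auto intro: finite_subset)
  qed
  have "\<exists>F1\<in>containing \<G>1 {z}. \<exists>F2\<in>containing \<G>2 {z}.
      card (F1 \<inter> F2) = card (insert z B1 \<inter> insert z B2) + m"
  proof (rule Suc.IH)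
    show "containing \<G>1 {z} \<subseteq> perm_graphs A" "containing \<G>2 {z} \<subseteq> perm_graphs A"
      using Suc.prems(1,2) by (auto simp: containing_def)
    show "fact n \<le> D * (2 * real r * real n) * real (card (containing \<G>1 {z}))"
      "fact n \<le> D * (2 * real r * real n) * real (card (containing \<G>2 {z}))"
      using dD d Suc.prems(3,4) by auto
    show "spread (K * L) R (containing \<G>1 {z}) (insert z B1)"
      "spread (K * L) R (containing \<G>2 {z}) (insert z B2)"
      using Suc.prems(5-7) finF z R0 L dL[OF d(1)] dL[OF d(2)]
      by (auto intro!: spread_restrict_to_cell)
    show "K * L > 0" using Suc.prems(7) L by simp
    show "card (insert z B1) + m \<le> b" "card (insert z B2) + m \<le> b"
      using Suc.prems(8,9) finB z by auto
    show "K * L * L ^ m \<le> Kmax" using Suc.prems(10) by (simp add: mult.assoc)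
    show "D * (2 * real r * real n) * (2 * real r * real n) ^ m \<le> Dmax"
      using Suc.prems(11) by (simp add: mult.assoc)
  qed
  moreover have "card (insert z B1 \<inter> insert z B2) = Suc (card (B1 \<inter> B2))"
  proof -
    have "insert z B1 \<inter> insert z B2 = insert z (B1 \<inter> B2)" by auto
    then show ?thesis using z finB by simp
  qed
  ultimately show ?case by (auto simp: containing_def)
qed

section \<open>Cores and the structure of families with a forbidden intersection\<close>

text \<open>
  Fix B0 in \<S>. Every member of \<S> contains one of the at most 2^q sets of size t inside B0. If such a
  set T0 is not common to all members, then some b T0 in \<S> does not contain it. A member
  B' containing T0 meets b T0 in at least t points, so it contains a point of b T0
  outside T0; there are at most q such points.
\<close>
lemma common_subset_or_few_larger_subsets:
  assumes B: "\<And>B. B \<in> \<S> \<Longrightarrow> finite B \<and> card B \<le> q"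
    and int: "\<And>B1 B2. B1 \<in> \<S> \<Longrightarrow> B2 \<in> \<S> \<Longrightarrow> t \<le> card (B1 \<inter> B2)"
  shows "(\<exists>T. card T = t \<and> (\<forall>B\<in>\<S>. T \<subseteq> B)) \<or>
    (\<exists>\<T>. finite \<T> \<and> card \<T> \<le> 2 ^ q * q \<and> (\<forall>T\<in>\<T>. card T = t + 1) \<and> (\<forall>B\<in>\<S>. \<exists>T\<in>\<T>. T \<subseteq> B))"
proof (cases "\<S> = {}")
  case True
  then show ?thesis by (intro disjI2 exI[of _ "{}"]) auto
next
  case False
  then obtain B0 where B0: "B0 \<in> \<S>" by auto
  show ?thesis
  proof (cases "\<exists>T. card T = t \<and> (\<forall>B\<in>\<S>. T \<subseteq> B)")
    case nocommon: False
    define \<T>0 where "\<T>0 = {T \<in> Pow B0. card T = t}"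
    have "\<forall>T\<in>\<T>0. \<exists>B\<in>\<S>. \<not> T \<subseteq> B" using nocommon by (auto simp: \<T>0_def)
    then obtain b where b: "\<And>T. T \<in> \<T>0 \<Longrightarrow> b T \<in> \<S> \<and> \<not> T \<subseteq> b T" by metis
    define \<T> where "\<T> = (\<Union>T\<in>\<T>0. (\<lambda>x. insert x T) ` (b T - T))"
    have fin0: "finite \<T>0" using B[OF B0] by (simp add: \<T>0_def)
    have "card \<T>0 \<le> card (Pow B0)" using B[OF B0] by (intro card_mono) (auto simp: \<T>0_def)
    also have "\<dots> \<le> 2 ^ q" using B[OF B0] by (simp add: card_Pow)
    finally have c0: "card \<T>0 \<le> 2 ^ q" .
    have cb: "finite (b T - T)" "card (b T - T) \<le> q" if "T \<in> \<T>0" for T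
    proof -
      have f: "finite (b T)" "card (b T) \<le> q" using b[OF that] B by auto
      then show "finite (b T - T)" by simp
      show "card (b T - T) \<le> q" using card_mono[of "b T" "b T - T"] f by auto
    qed
    have "card \<T> \<le> (\<Sum>T\<in>\<T>0. card ((\<lambda>x. insert x T) ` (b T - T)))"
      unfolding \<T>_def using fin0 by (rule card_UN_le)
    also have "\<dots> \<le> (\<Sum>T\<in>\<T>0. q)"
      using cb by (intro sum_mono) (rule order_trans[OF card_image_le])
    also have "\<dots> \<le> 2 ^ q * q" using c0 by simp
    finally have "card \<T> \<le> 2 ^ q * q" .
    moreover have "finite \<T>" unfolding \<T>_def using fin0 cb by blast
    moreover have "card T = t + 1" if T: "T \<in> \<T>" for T
    proof -
      obtain T0 x where T0: "T0 \<in> \<T>0" "x \<in> b T0 - T0" "T = insert x T0"  using T by (auto simp: \<T>_def)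
      moreover have "finite T0" using T0(1) B[OF B0] by (auto simp: \<T>0_def intro: finite_subset)
      ultimately show ?thesis by (simp add: \<T>0_def)
    qed
    moreover have "\<exists>T\<in>\<T>. T \<subseteq> B'" if B': "B' \<in> \<S>" for B'
    proof -
      obtain T0 where T0: "T0 \<subseteq> B' \<inter> B0" "card T0 = t"
        using int[OF B' B0] by (meson obtain_subset_with_card_n)
      then have T0': "T0 \<in> \<T>0" by (auto simp: \<T>0_def)
      have finT0: "finite T0" using T0 B[OF B0] by (auto intro: finite_subset)
      have "T0 \<inter> b T0 \<subset> T0" using b[OF T0'] by auto
      then have "card (T0 \<inter> b T0) < t" using psubset_card_mono[OF finT0] T0(2) by auto
      also have "t \<le> card (B' \<inter> b T0)" using int[OF B'] b[OF T0'] by auto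
      finally have "\<not> B' \<inter> b T0 \<subseteq> T0 \<inter> b T0"
        using card_mono[of "T0 \<inter> b T0" "B' \<inter> b T0"] finT0 by (auto simp: not_le[symmetric])
      then obtain x where "x \<in> B'" "x \<in> b T0 - T0" by auto
      then have "insert x T0 \<in> \<T>" "insert x T0 \<subseteq> B'" using T0' T0(1) by (auto simp: \<T>_def)
      then show ?thesis by blast
    qed
    ultimately show ?thesis by blast
  qed simp
qed

text \<open>
  The family \<G> witnesses that B is a core: it is spread over B and contains at least a 1 / D
  fraction of all n! permutations.
\<close>
definition core :: "nat \<Rightarrow> nat \<Rightarrow> real \<Rightarrow> real \<Rightarrow> 'a set set \<Rightarrow> 'a set \<Rightarrow> bool" where
  "core n q R D \<F> B \<longleftrightarrow> finite B \<and> card B \<le> q \<and>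
    (\<exists>\<G>\<subseteq>\<F>. spread 1 R \<G> B \<and> fact n \<le> D * real (card \<G>))"

lemma core_mono: "core n q R D \<F>' B \<Longrightarrow> \<F>' \<subseteq> \<F> \<Longrightarrow> core n q R D \<F> B"
  by (auto simp: core_def)

text \<open>
  Choose B maximizing f B = |containing \<F> B| R^|B|. Comparing f B with f X for X \<supseteq> B says
  precisely that containing \<F> B is spread over B. Comparing with f {} = |\<F>| > m shows
  that B is small, by the assumption on b > q, and that containing \<F> B is large.
\<close>
lemma ex_core:
  assumes A: "finite A" "card A = n" and \<F>: "\<F> \<subseteq> perm_graphs A" and R: "R \<ge> 1"
    and m: "m > 0" "m < real (card \<F>)"
    and tail: "\<And>b. q < b \<Longrightarrow> b \<le> n \<Longrightarrow> R ^ b * fact (n - b) \<le> m"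
    and D: "fact n * R ^ q \<le> D * m"
  shows "\<exists>B. core n q R D \<F> B \<and> (\<exists>F\<in>\<F>. B \<subseteq> F)"
proof -
  have fin\<F>: "finite \<F>" using \<F> finite_perm_graphs[OF A(1)] finite_subset by auto
  have memF: "finite F" "card F = n" if "F \<in> \<F>" for F
    using perm_graphs_member[of F A] that \<F> A by auto
  define f where "f = (\<lambda>X. real (card (containing \<F> X)) * R ^ card X)"
  define W where "W = (\<Union>F\<in>\<F>. Pow F)"
  have "\<F> \<noteq> {}" using m by auto
  then have emp: "{} \<in> W" by (auto simp: W_def)
  have finW: "finite W" using fin\<F> memF by (auto simp: W_def)
  have "Max (f ` W) \<in> f ` W" using finW emp by (intro Max_in) auto
  then obtain B where "B \<in> W" "f B = Max (f ` W)" by auto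
  then have B: "B \<in> W" "\<And>X. X \<in> W \<Longrightarrow> f X \<le> f B" using finW by auto
  obtain F where F: "F \<in> \<F>" "B \<subseteq> F" using B(1) by (auto simp: W_def)
  have finB: "finite B" "card B \<le> n" using F memF[OF F(1)] card_mono[of F B] by (auto intro: finite_subset)
  have "f {} = real (card \<F>)" by (simp add: f_def containing_def)
  then have fB: "m < f B" using B(2)[OF emp] m by linarith
  have "card (containing \<F> B) \<le> card (containing (perm_graphs A) B)"
    using \<F> finite_containing[OF finite_perm_graphs[OF A(1)]] by (intro card_mono) (auto simp: containing_def)
  also have "\<dots> \<le> fact (n - card B)" using card_containing_perm_graphs_le[OF A(1)] A by blast
  finally have "real (card (containing \<F> B)) \<le> real (fact (n - card B))" by (rule of_nat_mono)
  then have "f B \<le> fact (n - card B) * R ^ card B"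
    unfolding f_def using R by (intro mult_right_mono) auto
  then have cB: "card B \<le> q" using tail[of "card B"] finB fB by (force simp: mult.commute)
  have "spread 1 R (containing \<F> B) B"
    unfolding spread_def
  proof (intro conjI ballI allI impI)
    fix X assume X: "B \<subseteq> X"
    have eq: "containing (containing \<F> B) X = containing \<F> X" using X by (auto simp: containing_def)
    show "real (card (containing (containing \<F> B) X)) * R ^ card (X - B) \<le> 1 * real (card (containing \<F> B))"
    proof (cases "X \<in> W")
      case True
      then have finX: "finite X" using memF by (auto simp: W_def intro: finite_subset)
      have "card X = card (X - B) + card B" using X finX finB card_mono[OF finX X] by (simp add: card_Diff_subset)
      then have "R ^ card B * (real (card (containing \<F> X)) * R ^ card (X - B)) = f X"
        by (simp add: f_def power_add)
      also have "\<dots> \<le> R ^ card B * real (card (containing \<F> B))" using B(2)[OF True] by (simp add: f_def mult.commute)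
      finally show ?thesis unfolding eq mult_1 using R by (subst (asm) mult_le_cancel_left_pos) auto
    next
      case False
      then have "containing \<F> X = {}" by (auto simp: W_def containing_def)
      then show ?thesis by (simp add: eq)
    qed
  qed (auto simp: containing_def)
  moreover have "fact n \<le> D * real (card (containing \<F> B))"
  proof -
    have "0 < fact n * R ^ q" using R by simp
    then have "0 < D * m" using D by linarith
    then have D0: "0 < D" using m by (simp add: zero_less_mult_iff)
    have "f B \<le> real (card (containing \<F> B)) * R ^ q"
      unfolding f_def using R cB by (intro mult_left_mono power_increasing) auto
    then have "D * m \<le> D * (real (card (containing \<F> B)) * R ^ q)" using fB D0 by (intro mult_left_mono) auto
    then have "fact n * R ^ q \<le> (D * real (card (containing \<F> B))) * R ^ q" using D by (simp add: mult.assoc)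
    then show ?thesis using R by (subst (asm) mult_le_cancel_right_pos) auto
  qed
  moreover have "containing \<F> B \<subseteq> \<F>" by (auto simp: containing_def)
  ultimately show ?thesis using F finB cB unfolding core_def by blast
qed

text \<open>
  The constraints that the argument puts on its parameters: q bounds the size of cores,
  1 / D bounds the density of their witnesses from below, and a subfamily with more than m members has a core; r is
  the number of rows in the counting argument for dense cells, L the loss in the spread
  constant per added cell, and 2^M exceeds the size of the graphs. At most t cells are added,
  whence the powers L^t and (2 r n)^t and the bound q + t on the size of the enlarged cores.
\<close>
locale spread_parameters =
  fixes n t q r M :: nat and R L D m :: real
  assumes t: "t \<ge> 1" "3 * t + 1 \<le> n" and r: "4 * r \<le> n" "r \<ge> 1" and M: "M \<ge> 1" "n < 2 ^ M"
    and R: "8 * real M \<le> R" "2 * real (q + t) * L ^ t \<le> R" "32 * L ^ t * real M ^ 2 < R"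
    and L: "L \<ge> 1" "2 * real r * real n \<le> L * R"
    and D: "2 * (D * (2 * real r * real n) ^ t) * (2/3) ^ r < 1" "fact n * R ^ q \<le> D * m"
    and m_pos: "m > 0" and tail: "\<And>b. q < b \<Longrightarrow> b \<le> n \<Longrightarrow> R ^ b * fact (n - b) \<le> m"
    and m_small: "m < fact (n - 2 * t - 1)" "m + 2 ^ q * real q * fact (n - t - 1) < fact (n - t)"
begin

text \<open>
  If the cores met in fewer than t cells, their witnesses would contain two members that meet in
  exactly t - 1 cells.
\<close>
lemma cores_intersect:
  assumes A: "finite A" "card A = n" and \<F>: "\<F> \<subseteq> perm_graphs A"
    and forbidden: "\<And>F1 F2. F1 \<in> \<F> \<Longrightarrow> F2 \<in> \<F> \<Longrightarrow> F1 \<noteq> F2 \<Longrightarrow> card (F1 \<inter> F2) \<noteq> t - 1"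
    and B: "core n q R D \<F> B1" "core n q R D \<F> B2"
  shows "t \<le> card (B1 \<inter> B2)"
proof (rule ccontr)
  assume small: "\<not> ?thesis"
  define k where "k = t - 1 - card (B1 \<inter> B2)"
  have k: "card (B1 \<inter> B2) + k = t - 1" "k \<le> t" using small by (auto simp: k_def)
  obtain \<G>1 where \<G>1: "\<G>1 \<subseteq> \<F>" "spread 1 R \<G>1 B1" "fact n \<le> D * real (card \<G>1)"
    using B(1) by (auto simp: core_def)
  obtain \<G>2 where \<G>2: "\<G>2 \<subseteq> \<F>" "spread 1 R \<G>2 B2" "fact n \<le> D * real (card \<G>2)"
    using B(2) by (auto simp: core_def)
  have R1: "R \<ge> 1" using R(1) M by linarith
  have D0: "D > 0"
  proof -
    have "0 < fact n * R ^ q" using R1 by simp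
    then have "0 < D * m" using D(2) by linarith
    then show ?thesis using m_pos by (simp add: zero_less_mult_iff)
  qed
  have Lk: "1 * L ^ k \<le> L ^ t" using L k by (simp add: power_increasing)
  have rn: "real r * real n \<ge> 1"
  proof -
    have "1 * 1 \<le> real r * real n" using r t by (intro mult_mono) auto
    then show ?thesis by simp
  qed
  then have Dk: "D * (2 * real r * real n) ^ k \<le> D * (2 * real r * real n) ^ t"
    using D0 k by (intro mult_left_mono power_increasing) auto
  have L0: "0 < L" using L by simp
  have cB: "card B1 + k \<le> q + t" "card B2 + k \<le> q + t" using B k by (auto simp: core_def)
  have sub: "\<G>1 \<subseteq> perm_graphs A" "\<G>2 \<subseteq> perm_graphs A" using \<G>1(1) \<G>2(1) \<F> by auto
  obtain F1 F2 where F: "F1 \<in> \<G>1" "F2 \<in> \<G>2" "card (F1 \<inter> F2) = card (B1 \<inter> B2) + k"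
    using spread_families_prescribed_intersection[OF A r M R D(1) L0 L(2) sub \<G>1(3) \<G>2(3) \<G>1(2) \<G>2(2) _ cB Lk Dk]
    by auto
  have "F1 \<noteq> F2"
  proof
    assume "F1 = F2"
    then have "card (F1 \<inter> F2) = n" using perm_graphs_member(3)[of F1 A] F(1) sub A by auto
    then show False using F(3) k t by linarith
  qed
  then show False using forbidden[of F1 F2] F \<G>1(1) \<G>2(1) k by auto
qed

text \<open>
  A larger subfamily would itself have a core, which is also a core of \<F> and lies in one of
  its members.
\<close>
lemma card_without_cores_le:
  assumes A: "finite A" "card A = n" and \<F>: "\<F> \<subseteq> perm_graphs A" and sub: "\<F>' \<subseteq> \<F>"
    and none: "\<And>B F. core n q R D \<F> B \<Longrightarrow> F \<in> \<F>' \<Longrightarrow> \<not> B \<subseteq> F"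
  shows "real (card \<F>') \<le> m"
proof (rule ccontr)
  assume "\<not> ?thesis"
  moreover have "R \<ge> 1" using R(1) M by linarith
  moreover have "\<F>' \<subseteq> perm_graphs A" using sub \<F> by auto
  ultimately obtain B F where "core n q R D \<F>' B" "F \<in> \<F>'" "B \<subseteq> F"
    using ex_core[OF A, of \<F>' R m q D] m_pos tail D(2) by (auto simp: not_le)
  then show False using none core_mono[OF _ sub] by blast
qed

text \<open>
  This is the stability form of the theorem: if all cores share a set T of t cells, then either
  every member of \<F> contains T, or the graphs through T that a single exceptional member excludes
  outnumber all exceptional members.
\<close>
theorem small_or_contained_in_coset:
  assumes A: "finite A" "card A = n" and \<F>: "\<F> \<subseteq> perm_graphs A"
    and forbidden: "\<And>F1 F2. F1 \<in> \<F> \<Longrightarrow> F2 \<in> \<F> \<Longrightarrow> F1 \<noteq> F2 \<Longrightarrow> card (F1 \<inter> F2) \<noteq> t - 1"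
  shows "card \<F> < fact (n - t) \<or> (\<exists>T. card T = t \<and> \<F> \<subseteq> containing (perm_graphs A) T)"
proof -
  have fin\<F>: "finite \<F>" using \<F> finite_perm_graphs[OF A(1)] finite_subset by auto
  have finP: "finite (containing (perm_graphs A) T)" for T
    by (rule finite_containing[OF finite_perm_graphs[OF A(1)]])
  define \<S> where "\<S> = {B. core n q R D \<F> B}"
  have "(\<exists>T. card T = t \<and> (\<forall>B\<in>\<S>. T \<subseteq> B)) \<or>
    (\<exists>\<T>. finite \<T> \<and> card \<T> \<le> 2 ^ q * q \<and> (\<forall>T\<in>\<T>. card T = t + 1) \<and> (\<forall>B\<in>\<S>. \<exists>T\<in>\<T>. T \<subseteq> B))"
    by (rule common_subset_or_few_larger_subsets)
      (use cores_intersect[OF A \<F> forbidden] in \<open>auto simp: \<S>_def core_def\<close>)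
  then show ?thesis
  proof
    assume "\<exists>\<T>. finite \<T> \<and> card \<T> \<le> 2 ^ q * q \<and> (\<forall>T\<in>\<T>. card T = t + 1) \<and> (\<forall>B\<in>\<S>. \<exists>T\<in>\<T>. T \<subseteq> B)"
    then obtain \<T> where \<T>: "finite \<T>" "card \<T> \<le> 2 ^ q * q" "\<And>T. T \<in> \<T> \<Longrightarrow> card T = t + 1"
      "\<And>B. B \<in> \<S> \<Longrightarrow> \<exists>T\<in>\<T>. T \<subseteq> B" by blast
    define \<F>0 where "\<F>0 = {F \<in> \<F>. \<forall>T\<in>\<T>. \<not> T \<subseteq> F}"
    have m0: "real (card \<F>0) \<le> m"
    proof (rule card_without_cores_le[OF A \<F>])
      show "\<not> B \<subseteq> F" if B: "core n q R D \<F> B" and F: "F \<in> \<F>0" for B F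
      proof
        assume "B \<subseteq> F"
        obtain T where "T \<in> \<T>" "T \<subseteq> B" using \<T>(4)[of B] B by (auto simp: \<S>_def)
        then have "T \<subseteq> F" using \<open>B \<subseteq> F\<close> by blast
        then show False using F \<open>T \<in> \<T>\<close> by (auto simp: \<F>0_def)
      qed
    qed (auto simp: \<F>0_def)
    have "\<F> \<subseteq> \<F>0 \<union> (\<Union>T\<in>\<T>. containing (perm_graphs A) T)"
      using \<F> by (auto simp: \<F>0_def containing_def)
    then have "card \<F> \<le> card (\<F>0 \<union> (\<Union>T\<in>\<T>. containing (perm_graphs A) T))"
      using finP \<T>(1) fin\<F> by (intro card_mono) (auto simp: \<F>0_def)
    also have "\<dots> \<le> card \<F>0 + card (\<Union>T\<in>\<T>. containing (perm_graphs A) T)" by (rule card_Un_le)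
    also have "card (\<Union>T\<in>\<T>. containing (perm_graphs A) T) \<le> (\<Sum>T\<in>\<T>. card (containing (perm_graphs A) T))"
      using \<T>(1) by (rule card_UN_le)
    also have "\<dots> \<le> (\<Sum>T\<in>\<T>. fact (n - t - 1))"
    proof (rule sum_mono)
      fix T assume "T \<in> \<T>"
      then show "card (containing (perm_graphs A) T) \<le> fact (n - t - 1)"
        using card_containing_perm_graphs_le[OF A(1), of T] \<T>(3) A by simp
    qed
    also have "\<dots> \<le> 2 ^ q * q * fact (n - t - 1)" using \<T>(2) by simp
    finally have "real (card \<F>) \<le> real (card \<F>0 + 2 ^ q * q * fact (n - t - 1))" by (simp only: of_nat_le_iff)
    also have "\<dots> = real (card \<F>0) + 2 ^ q * real q * fact (n - t - 1)" by simp
    also have "\<dots> < fact (n - t)" using m0 m_small(2) by linarith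
    finally have "real (card \<F>) < real (fact (n - t))" by simp
    then show ?thesis by (simp only: of_nat_less_iff simp_thms)
  next
    assume "\<exists>T. card T = t \<and> (\<forall>B\<in>\<S>. T \<subseteq> B)"
    then obtain T where T: "card T = t" "\<And>B. B \<in> \<S> \<Longrightarrow> T \<subseteq> B" by auto
    \<comment> \<open>the exceptional members; none of them contains a core\<close>
    define \<F>0 where "\<F>0 = {F \<in> \<F>. \<not> T \<subseteq> F}"
    have m0: "real (card \<F>0) \<le> m"
      by (rule card_without_cores_le[OF A \<F>]) (use T(2) in \<open>auto simp: \<F>0_def \<S>_def\<close>)
    show ?thesis
    proof (cases "\<F>0 = {}")
      case True
      then have "\<F> \<subseteq> containing (perm_graphs A) T" using \<F> by (auto simp: \<F>0_def containing_def)
      then show ?thesis using T(1) by blast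
    next
      case False
      then obtain F0 where F0: "F0 \<in> \<F>" "\<not> T \<subseteq> F0" by (auto simp: \<F>0_def)
      have split: "card \<F> \<le> card \<F>0 + card (containing \<F> T)"
      proof -
        have "\<F> = \<F>0 \<union> containing \<F> T" by (auto simp: \<F>0_def containing_def)
        then show ?thesis by (metis card_Un_le)
      qed
      have upper: "card (containing \<F> T) + fact (n - 2 * t - 1) \<le> fact (n - t)"
      proof (cases "containing \<F> T = {}")
        case True
        then show ?thesis by (auto intro: fact_mono)
      next
        case False
        then obtain F where F: "F \<in> \<F>" "T \<subseteq> F" by (auto simp: containing_def)
        obtain \<tau> where \<tau>: "\<tau> permutes A" "F = perm_graph A \<tau>" using F \<F> by (auto simp: perm_graphs_def)
        obtain \<sigma> where \<sigma>: "\<sigma> permutes A" "F0 = perm_graph A \<sigma>" using F0 \<F> by (auto simp: perm_graphs_def)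
        obtain S where S: "S \<subseteq> A" "T = perm_graph S \<tau>"
          using F(2) unfolding \<tau>(2) perm_graph_def by (meson subset_imageE)
        have cS: "card S = t" using T(1) by (simp add: S(2) card_perm_graph)
        have differ: "\<exists>i\<in>S. \<sigma> i \<noteq> \<tau> i" using F0(2) S by (auto simp: \<sigma>(2) perm_graph_def)
        define G where "G = {\<rho>. \<rho> permutes A \<and> (\<forall>i\<in>S. \<rho> i = \<tau> i) \<and> card {i \<in> A. \<rho> i = \<sigma> i} = t - 1}"
        have G: "fact (n - 2 * t - 1) \<le> card G"
          using many_perms_agreeing_exactly[OF A(1) \<sigma>(1) \<tau>(1) S(1) cS differ] t(2) A by (simp add: G_def)
        have "card (perm_graph A ` G) = card G"
          by (rule card_image, rule inj_on_subset[OF inj_on_perm_graph]) (auto simp: G_def)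
        moreover have "perm_graph A ` G \<subseteq> containing (perm_graphs A) T - containing \<F> T"
        proof (rule image_subsetI)
          fix \<rho> assume \<rho>: "\<rho> \<in> G"
          have "T \<subseteq> perm_graph A \<rho>" using \<rho> S by (auto simp: G_def perm_graph_def)
          moreover have "card (perm_graph A \<rho> \<inter> F0) = t - 1"
            using \<rho> by (simp add: \<sigma>(2) perm_graph_Int card_perm_graph G_def)
          ultimately have "perm_graph A \<rho> \<notin> \<F>" using forbidden[OF _ F0(1)] F0(2) by metis
          then show "perm_graph A \<rho> \<in> containing (perm_graphs A) T - containing \<F> T"
            using \<rho> \<open>T \<subseteq> perm_graph A \<rho>\<close> by (auto simp: containing_def perm_graphs_def G_def)
        qed
        then have "card (perm_graph A ` G) \<le> card (containing (perm_graphs A) T - containing \<F> T)"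
          using finP by (intro card_mono) auto
        moreover have sub: "containing \<F> T \<subseteq> containing (perm_graphs A) T" using \<F> by (auto simp: containing_def)
        then have "card (containing (perm_graphs A) T - containing \<F> T) =
            card (containing (perm_graphs A) T) - card (containing \<F> T)"
          using finite_containing[OF fin\<F>] by (intro card_Diff_subset)
        moreover have "card (containing \<F> T) \<le> card (containing (perm_graphs A) T)"
          using sub finP by (intro card_mono)
        moreover have "card (containing (perm_graphs A) T) \<le> fact (n - t)"
          using card_containing_perm_graphs_le[OF A(1), of T] T(1) A by simp
        ultimately show ?thesis using G by linarith
      qed
      have "card \<F> + fact (n - 2 * t - 1) \<le> card \<F>0 + fact (n - t)" using split upper by linarith
      then have "real (card \<F> + fact (n - 2 * t - 1)) \<le> real (card \<F>0 + fact (n - t))"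
        by (simp only: of_nat_le_iff)
      then have "real (card \<F>) + fact (n - 2 * t - 1) \<le> real (card \<F>0) + fact (n - t)" by simp
      then have "real (card \<F>) < fact (n - t)" using m0 m_small(1) by linarith
      then have "real (card \<F>) < real (fact (n - t))" by simp
      then show ?thesis by (simp only: of_nat_less_iff simp_thms)
    qed
  qed
qed

end

section \<open>Existence of parameters\<close>

lemma fact_add_le: "fact (m + r) \<le> ((m + r) ^ r * fact m :: nat)"
proof (induction r)
  case (Suc r)
  have "fact (m + Suc r) = (m + Suc r) * (fact (m + r) :: nat)" by simp
  also have "\<dots> \<le> (m + Suc r) * ((m + r) ^ r * fact m)" using Suc by (intro mult_left_mono) auto
  also have "\<dots> \<le> (m + Suc r) * ((m + Suc r) ^ r * fact m)"
    by (intro mult_left_mono mult_right_mono power_mono) auto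
  finally show ?case by (simp add: mult_ac)
qed simp

text \<open>
  Fixing b values of a permutation leaves at most a fraction (3 / n)^b of all permutations. This
  combines (n / b)^b \<le> (n choose b) with b^b / b! \<le> exp b \<le> 3^b.
\<close>
lemma power_third_mult_fact_le:
  assumes "b \<le> n"
  shows "(real n / 3) ^ b * fact (n - b) \<le> fact n"
proof (cases "b = 0")
  case False
  have "real b ^ b / fact b \<le> (\<Sum>k. real b ^ k /\<^sub>R fact k)"
    using sum_le_suminf[OF summable_exp_generic[of "real b"], of "{b}"] by (simp add: field_simps)
  then have "real b ^ b / fact b \<le> exp (real b)" by (simp add: exp_def)
  also have "exp (real b) = exp 1 ^ b" by (simp flip: exp_of_nat_mult)
  also have "\<dots> \<le> 3 ^ b" using exp_le by (intro power_mono) auto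
  finally have e: "real b ^ b \<le> 3 ^ b * fact b" by (simp add: field_simps)
  have "(real n / 3) ^ b * fact (n - b) = (real n / real b) ^ b * (real b ^ b / 3 ^ b) * fact (n - b)"
    using False by (simp add: power_divide)
  also have "\<dots> \<le> real (n choose b) * fact b * fact (n - b)"
    using binomial_ge_n_over_k_pow_k[OF assms, where 'a = real] e
    by (intro mult_right_mono mult_mono) (auto simp: field_simps)
  also have "\<dots> = real (fact b * fact (n - b) * (n choose b))" by simp
  also have "\<dots> = fact n" by (simp only: binomial_fact_lemma[OF assms] of_nat_fact)
  finally show ?thesis .
qed simp

text \<open>
  Everything is expressed through x = n^(1 / d) with d = 2 t + 3. Take R = n / x, so that fixing b
  cells beats R^b by a factor (x / 3)^b; a constant number q of cells then yields any fixed power of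
  n, here n^(2 t + 2). The step to a common dense cell loses 2 r n / R \<le> x^2 when r is about x / 2.
  The t steps lose x^(2 t) in total, and the exponent d is such that R = x^(2 t) x^2 still
  leaves x^2 to spare for the factors q + t and M^2, with M about x / 8. The remaining
  requirements compare a power of x with an exponential in x.
\<close>
lemma spread_parameters_exist:
  fixes t :: nat
  assumes t: "t \<ge> 1"
  shows "\<exists>n0. \<forall>n\<ge>n0. \<exists>q r M R L D m. spread_parameters n t q r M R L D m"
proof -
  define d where "d = 2 * t + 3"
  define q where "q = 2 * d * (2 * t + 2)"
  define N where "N = d * (4 * t + 2 + q)"
  have "\<forall>\<^sub>F x :: real in at_top. x ^ d < 2 powr (x / 8 - 1)" by real_asymp
  moreover have "\<forall>\<^sub>F x :: real in at_top. 2 * x ^ N * (2/3) powr (x / 2 - 1) < 1" by real_asymp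
  moreover have "\<forall>\<^sub>F x :: real in at_top. 16 \<le> x \<and> 2 * real (q + t) \<le> x"
    by (intro eventually_conj eventually_ge_at_top)
  ultimately have "\<forall>\<^sub>F x :: real in at_top. x ^ d < 2 powr (x / 8 - 1) \<and>
      2 * x ^ N * (2/3) powr (x / 2 - 1) < 1 \<and> 16 \<le> x \<and> 2 * real (q + t) \<le> x"
    by eventually_elim simp
  moreover have "filterlim (\<lambda>n. root d (real n)) at_top at_top"
    using t by (subst d_def) real_asymp
  ultimately have "\<forall>\<^sub>F n in sequentially. root d (real n) ^ d < 2 powr (root d (real n) / 8 - 1) \<and>
      2 * root d (real n) ^ N * (2/3) powr (root d (real n) / 2 - 1) < 1 \<and> 16 \<le> root d (real n) \<and>
      2 * real (q + t) \<le> root d (real n)"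
    by (rule eventually_compose_filterlim)
  moreover have "\<forall>\<^sub>F n in sequentially. 3 * t + 1 \<le> n \<and> t + 2 + 2 ^ q * q \<le> n"
    by (intro eventually_conj eventually_ge_at_top)
  ultimately have "\<forall>\<^sub>F n in sequentially. \<exists>q r M R L D m. spread_parameters n t q r M R L D m"
  proof eventually_elim
    case (elim n)
    define x where "x = root d (real n)"
    have x: "x ^ d < 2 powr (x / 8 - 1)" "2 * x ^ N * (2/3) powr (x / 2 - 1) < 1" "16 \<le> x"
      "2 * real (q + t) \<le> x" using elim by (auto simp: x_def)
    have n: "3 * t + 1 \<le> n" "t + 2 + 2 ^ q * q \<le> n" using elim by auto
    have xd: "x ^ d = real n" by (simp add: x_def d_def real_root_pow_pos2)
    define R where "R = x ^ (d - 1)"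
    define r where "r = nat \<lfloor>x / 2\<rfloor>"
    define M where "M = nat \<lfloor>x / 8\<rfloor>"
    define m where "m = (fact n :: real) / real n ^ (2 * t + 2)"
    define D where "D = real n ^ (2 * t + 2) * R ^ q"
    have n0: "real n > 0" using n by simp
    have floor_bounds: "y - 1 \<le> real (nat \<lfloor>y\<rfloor>)" "real (nat \<lfloor>y\<rfloor>) \<le> y" if "0 \<le> y" for y :: real
      using that by linarith+
    have r_bounds: "x / 2 - 1 \<le> real r" "real r \<le> x / 2"
      unfolding r_def by (rule floor_bounds, use x(3) in simp)+
    have M_bounds: "x / 8 - 1 \<le> real M" "real M \<le> x / 8"
      unfolding M_def by (rule floor_bounds, use x(3) in simp)+
    have "d = Suc (d - 1)" by (simp add: d_def)
    then have xR: "x * R = real n" unfolding R_def by (metis power_Suc xd)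
    have R_eq: "R = (x ^ 2) ^ t * x ^ 2"
      by (simp only: R_def power_mult[symmetric] power_add[symmetric]) (simp add: d_def)
    have xt: "1 \<le> x ^ k" for k using x(3) by (intro one_le_power) auto
    have x2: "x \<le> x ^ 2" using x(3) by (intro self_le_power) auto
    have "1 * x ^ 2 \<le> (x ^ 2) ^ t * x ^ 2" by (intro mult_right_mono one_le_power xt) auto
    then have x2R: "x ^ 2 \<le> R" by (simp only: R_eq mult_1)
    then have xleR: "x \<le> R" using x2 by linarith
    have "16 * R \<le> x * R" using x(3) xleR by (intro mult_right_mono) auto
    then have Rn: "16 * R \<le> real n" using xR by simp
    have "spread_parameters n t q r M R (x ^ 2) D m"
    proof unfold_locales
      show "t \<ge> 1" "3 * t + 1 \<le> n" by fact+
      show "4 * r \<le> n" using r_bounds(2) Rn xleR x(3) by linarith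
      show "r \<ge> 1" using r_bounds(1) x(3) by linarith
      show "M \<ge> 1" using M_bounds(1) x(3) by linarith
      have "real n < 2 powr (x / 8 - 1)" using x(1) xd by simp
      also have "\<dots> \<le> 2 powr real M" using M_bounds by (intro powr_mono) auto
      also have "\<dots> = real (2 ^ M)" by (simp add: powr_realpow)
      finally show "n < 2 ^ M" by (simp only: of_nat_less_iff)
      show "8 * real M \<le> R" using M_bounds(2) xleR by linarith
      have "2 * real (q + t) * (x ^ 2) ^ t \<le> x ^ 2 * (x ^ 2) ^ t"
        using x(4) x2 by (intro mult_right_mono) auto
      then show "2 * real (q + t) * (x ^ 2) ^ t \<le> R" by (simp only: R_eq mult.commute)
      have "real M ^ 2 \<le> (x / 8) ^ 2" using M_bounds by (intro power_mono) auto
      then have "32 * real M ^ 2 \<le> x ^ 2 / 2" by (simp add: power_divide)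
      then have "32 * real M ^ 2 < x ^ 2" using xt[of 2] by linarith
      then have "(x ^ 2) ^ t * (32 * real M ^ 2) < (x ^ 2) ^ t * x ^ 2"
        using x(3) by (intro mult_strict_left_mono) auto
      then show "32 * (x ^ 2) ^ t * real M ^ 2 < R" by (simp only: R_eq mult_ac)
      show "1 \<le> x ^ 2" by (rule xt)
      have "2 * real r * real n \<le> x * real n" using r_bounds by (intro mult_right_mono) auto
      also have "\<dots> = x ^ 2 * R" using xR by (simp add: power2_eq_square mult.assoc)
      finally show "2 * real r * real n \<le> x ^ 2 * R" .
      show "fact n * R ^ q \<le> D * m" using n0 by (simp add: D_def m_def)
      show "m > 0" using n0 by (simp add: m_def)
      have "2 * real r * real n \<le> real n * real n" using r_bounds Rn xleR x(3) by (intro mult_right_mono) auto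
      then have "(2 * real r * real n) ^ t \<le> (real n * real n) ^ t" by (intro power_mono) auto
      also have "\<dots> = real n ^ (2 * t)" by (simp add: power_mult power2_eq_square)
      finally have rt: "(2 * real r * real n) ^ t \<le> real n ^ (2 * t)" .
      have "R ^ q \<le> real n ^ q" using Rn xleR x(3) by (intro power_mono) auto
      then have "D \<le> real n ^ (2 * t + 2) * real n ^ q" unfolding D_def by (intro mult_left_mono) auto
      then have "D * (2 * real r * real n) ^ t \<le> (real n ^ (2 * t + 2) * real n ^ q) * real n ^ (2 * t)"
        using rt n0 by (intro mult_mono) auto
      also have "\<dots> = real n ^ (4 * t + 2 + q)" by (simp add: power_add[symmetric] algebra_simps)
      also have "\<dots> = x ^ N" by (simp only: N_def power_mult xd)
      finally have DN: "D * (2 * real r * real n) ^ t \<le> x ^ N" .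
      have "(2/3) ^ r = (2/3 :: real) powr real r" by (simp add: powr_realpow)
      also have "\<dots> \<le> (2/3) powr (x / 2 - 1)" using r_bounds(1) by (intro powr_mono') auto
      finally have "2 * (D * (2 * real r * real n) ^ t) * (2/3) ^ r \<le> 2 * x ^ N * (2/3) powr (x / 2 - 1)"
        using DN x(3) by (intro mult_mono) (auto simp: D_def R_def)
      then show "2 * (D * (2 * real r * real n) ^ t) * (2/3) ^ r < 1" using x(2) by linarith
      \<comment> \<open>for large x one has (3 / x)^2 \<le> 1 / x, so q = 2 d (2 t + 2) factors give n^(- (2 t + 2))\<close>
      show "R ^ b * fact (n - b) \<le> m" if b: "q < b" "b \<le> n" for b
      proof -
        have "R = real n / 3 * (3 / x)" using xR x(3) by (simp add: field_simps)
        then have "R ^ b * fact (n - b) = (3 / x) ^ b * ((real n / 3) ^ b * fact (n - b))"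
          by (simp add: power_mult_distrib power_divide)
        also have "\<dots> \<le> (3 / x) ^ b * fact n"
          using power_third_mult_fact_le[OF b(2)] x(3) by (intro mult_left_mono) auto
        also have "(3 / x) ^ b \<le> (3 / x) ^ q" using x(3) b by (intro power_decreasing) auto
        then have "(3 / x) ^ b * fact n \<le> (3 / x) ^ q * fact n" by (intro mult_right_mono) auto
        also have "(3 / x) ^ q = ((3 / x) ^ 2) ^ (d * (2 * t + 2))"
          by (simp only: q_def power_mult[symmetric] mult.assoc)
        also have "((3 / x) ^ 2) ^ (d * (2 * t + 2)) * fact n \<le> (1 / x) ^ (d * (2 * t + 2)) * fact n"
        proof (intro mult_right_mono power_mono)
          show "(3 / x) ^ 2 \<le> 1 / x" using x(3) by (simp add: power_divide power2_eq_square field_simps)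
        qed auto
        also have "(1 / x) ^ (d * (2 * t + 2)) = 1 / real n ^ (2 * t + 2)"
          by (simp only: power_mult power_divide xd power_one)
        finally show ?thesis by (simp add: m_def)
      qed
      have "fact n \<le> n ^ (2 * t + 1) * (fact (n - 2 * t - 1) :: nat)"
        using fact_add_le[of "n - 2 * t - 1" "2 * t + 1"] n(1) by simp
      then have "real (fact n) \<le> real (n ^ (2 * t + 1) * fact (n - 2 * t - 1))" by (rule of_nat_mono)
      then have "fact n \<le> real n ^ (2 * t + 1) * fact (n - 2 * t - 1)" by simp
      also have "\<dots> < real n ^ (2 * t + 2) * fact (n - 2 * t - 1)"
        using n by (intro mult_strict_right_mono power_strict_increasing) auto
      finally show m_less: "m < fact (n - 2 * t - 1)"
        using n0 by (simp add: m_def field_simps)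
      have "(fact (n - 2 * t - 1) :: real) \<le> fact (n - t - 1)" by (intro fact_mono) auto
      then have "m + 2 ^ q * real q * fact (n - t - 1) < (1 + 2 ^ q * real q) * fact (n - t - 1)"
        using m_less by (simp add: distrib_right)
      also have "\<dots> \<le> real (n - t) * fact (n - t - 1)"
      proof (rule mult_right_mono)
        have "real (1 + 2 ^ q * q) \<le> real (n - t)" using n(2) by (intro of_nat_mono) linarith
        then show "1 + 2 ^ q * real q \<le> real (n - t)" by simp
      qed simp
      also have "\<dots> = fact (n - t)" using n by (simp add: fact_reduce)
      finally show "m + 2 ^ q * real q * fact (n - t - 1) < fact (n - t)" .
    qed
    then show ?case by blast
  qed
  then show ?thesis by (simp add: eventually_sequentially)
qed

section \<open>Families of permutations with a forbidden agreement\<close>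

theorem theorem1p1:
  fixes t :: nat
  shows "\<exists>n0::nat. \<forall>n\<ge>n0. \<forall>F. F \<subseteq> carrier (sym_group n) \<longrightarrow>
    intersection_free n (int t - 1) F \<longrightarrow>
      card F \<le> fact (n - t) \<and> (card F = fact (n - t) \<longrightarrow> is_stabilizer_coset n t F)"
proof (cases "t = 0")
  case True
  have "card F \<le> fact n \<and> (card F = fact n \<longrightarrow> is_stabilizer_coset n 0 F)"
    if F: "F \<subseteq> carrier (sym_group n)" for n F
  proof -
    have carr: "carrier (sym_group n) = {\<sigma>. \<sigma> permutes {1..n}}" by (simp add: sym_group_def)
    have fin: "finite (carrier (sym_group n))" and card: "card (carrier (sym_group n)) = fact n"
      unfolding carr by (simp_all add: finite_permutations card_permutations)
    have "is_stabilizer_coset n 0 F" if "card F = fact n"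
    proof -
      have "F = carrier (sym_group n)" using card_subset_eq[OF fin F] that card by simp
      moreover have id: "id \<in> carrier (sym_group n)" by (simp add: carr permutes_id)
      ultimately have "F = id <#\<^bsub>sym_group n\<^esub> pointwise_stabilizer n {}"
        unfolding l_coset_pointwise_stabilizer[OF id] by simp
      then show ?thesis
        unfolding is_stabilizer_coset_def using id by (intro exI[of _ "{}"] exI[of _ id]) simp
    qed
    then show ?thesis using card_mono[OF fin F] card by simp
  qed
  then show ?thesis using True by simp
next
  case False
  \<comment> \<open>the forbidden number t - 1 is now a natural number\<close>
  then have t: "t \<ge> 1" by simp
  from spread_parameters_exist[OF t] obtain n0
    where n0: "\<And>n. n \<ge> n0 \<Longrightarrow> \<exists>q r M R L D m. spread_parameters n t q r M R L D m" by blast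
  have "card F \<le> fact (n - t) \<and> (card F = fact (n - t) \<longrightarrow> is_stabilizer_coset n t F)"
    if n: "n \<ge> n0" and F: "F \<subseteq> carrier (sym_group n)" and free: "intersection_free n (int t - 1) F" for n F
  proof -
    obtain q r M R L D m where "spread_parameters n t q r M R L D m" using n0[OF n] by blast
    then interpret spread_parameters n t q r M R L D m .
    define A where "A = {1..n}"
    have A: "finite A" "card A = n" by (simp_all add: A_def)
    have carr: "carrier (sym_group n) = {\<sigma>. \<sigma> permutes A}" by (simp add: sym_group_def A_def)
    let ?\<F> = "perm_graph A ` F"
    have sub: "?\<F> \<subseteq> perm_graphs A" using F by (auto simp: carr perm_graphs_def)
    have cF: "card ?\<F> = card F"
      using F by (intro card_image inj_on_subset[OF inj_on_perm_graph]) (simp add: carr)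
    have "card (F1 \<inter> F2) \<noteq> t - 1" if F12: "F1 \<in> ?\<F>" "F2 \<in> ?\<F>" "F1 \<noteq> F2" for F1 F2
    proof -
      obtain \<sigma> \<tau> where st: "\<sigma> \<in> F" "\<tau> \<in> F" "F1 = perm_graph A \<sigma>" "F2 = perm_graph A \<tau>" using F12 by blast
      then have "int (card (agreement_set n \<sigma> \<tau>)) \<noteq> int t - 1"
        using free F12(3) by (auto simp: intersection_free_def)
      then show ?thesis
        using t by (auto simp: st perm_graph_Int card_perm_graph agreement_set_def A_def)
    qed
    from small_or_contained_in_coset[OF A sub this]
    show ?thesis
    proof
      assume "card ?\<F> < fact (n - t)"
      then show ?thesis by (simp add: cF)
    next
      assume "\<exists>T. card T = t \<and> ?\<F> \<subseteq> containing (perm_graphs A) T"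
      then obtain T where T: "card T = t" "?\<F> \<subseteq> containing (perm_graphs A) T" by auto
      have fin: "finite (containing (perm_graphs A) T)"
        by (rule finite_containing[OF finite_perm_graphs[OF A(1)]])
      have le: "card (containing (perm_graphs A) T) \<le> fact (n - t)"
        using card_containing_perm_graphs_le[OF A(1), of T] T(1) A(2) by simp
      have le': "card F \<le> card (containing (perm_graphs A) T)" using card_mono[OF fin T(2)] cF by simp
      have "is_stabilizer_coset n t F" if eq: "card F = fact (n - t)"
      proof -
        have all: "?\<F> = containing (perm_graphs A) T"
          using le le' eq cF by (intro card_subset_eq[OF fin T(2)]) simp
        have "F \<noteq> {}" using eq fact_nonzero[of "n - t", where 'a = nat] by auto
        then obtain \<tau> where \<tau>: "\<tau> \<in> F" by auto
        then have "T \<subseteq> perm_graph A \<tau>" using T(2) by (auto simp: containing_def)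
        then obtain S where S: "S \<subseteq> A" "T = perm_graph S \<tau>"
          unfolding perm_graph_def by (meson subset_imageE)
        have cS: "card S = t" using T(1) by (simp add: S(2) card_perm_graph)
        have iff: "\<sigma> \<in> F \<longleftrightarrow> (\<forall>j\<in>S. \<sigma> j = \<tau> j)" if \<sigma>: "\<sigma> permutes A" for \<sigma>
        proof -
          have "\<sigma> \<in> F \<longleftrightarrow> perm_graph A \<sigma> \<in> ?\<F>"
            using inj_on_image_mem_iff[OF inj_on_perm_graph, of \<sigma> A F] \<sigma> F by (simp add: carr)
          also have "\<dots> \<longleftrightarrow> T \<subseteq> perm_graph A \<sigma>" using \<sigma> by (auto simp: all containing_def perm_graphs_def)
          also have "\<dots> \<longleftrightarrow> (\<forall>j\<in>S. \<sigma> j = \<tau> j)" using S(1) by (auto simp: S(2) perm_graph_def)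
          finally show ?thesis .
        qed
        have \<tau>c: "\<tau> \<in> carrier (sym_group n)" using \<tau> F by blast
        have "F = \<tau> <#\<^bsub>sym_group n\<^esub> pointwise_stabilizer n S"
          unfolding l_coset_pointwise_stabilizer[OF \<tau>c] using iff F by (auto simp: carr)
        then show ?thesis
          unfolding is_stabilizer_coset_def using S(1) cS \<tau>c by (intro exI[of _ S] exI[of _ \<tau>]) (simp add: A_def)
      qed
      then show ?thesis using le le' by simp
    qed
  qed
  then show ?thesis by blast
qed

end
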